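(* Consider a sequence of asymmetric hub models with $n_L\to\infty$, $n\to\infty$, $T\to\infty$, satisfying the standing assumption on $\rho$ in the context. Let $d,v\in(0,1]$ (possibly depending on the index of the sequence) be such that: (i) for each $i=1,\dots,n_L$ there exists a set $V_i\subset\{1,\dots,n\}$ with $|V_i|\ge vn/n_L$ and $A_{ij}-A_{i'j}\ge d$ for all $j\in V_i$ and all $i'\in\{1,\dots,n_L\}$, $i'\ne i$; (ii) $A_{ii'}\le c_0/n_L$ for all $i,i'\in\{1,\dots,n_L\}$, $i\ne i'$, where $c_0$ is a positive constant. If $(n_L^2\log n_L)/T=o(1)$, $(n_L^3\log T)/(d^2vT)=o(1)$, $(n_L^4\log n_L)/(d^4v^2n)=o(1)$ and $(n_L\log n)/T=o(1)$, then $$\max_{i\in\{1,\dots,n_L\},\,j\in\{1,\dots,n\}}\left|\hat A_{ij}^{\hat z}-A_{ij}\right|=o_p(1).$$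
   Context: Asymmetric hub model: nodes $1,\dots,n$; leaders (possible hubs) $1,\dots,n_L$ with $n_L\le n$; parameters $\rho=(\rho_1,\dots,\rho_{n_L})$ with $\rho_i\ge0$, $\sum_i\rho_i=1$, and $A\in[0,1]^{n_L\times n}$ with $A_{ii}=1$ for $i\le n_L$. Independently for $t=1,\dots,T$, a latent hub $z_*^{(t)}\in\{1,\dots,n_L\}$ is drawn with $\mathbb P(z_*^{(t)}=i)=\rho_i$, and given $z_*^{(t)}=i$ the variables $G_j^{(t)}\in\{0,1\}$, $j=1,\dots,n$, are independent with $\mathbb P(G_j^{(t)}=1\mid z_*^{(t)}=i)=A_{ij}$. Only $G$ is observed. Profile likelihood estimator: for an assignment $z=(z^{(1)},\dots,z^{(T)})\in\{1,\dots,n_L\}^T$ let $t_i=\sum_t1(z^{(t)}=i)$, $\hat A^z_{ij}=\frac{1}{t_i}\sum_tG_j^{(t)}1(z^{(t)}=i)$ (set to $0$, say, if $t_i=0$), and $$L_G(z)=\sum_{t=1}^T\sum_{j=1}^n G_j^{(t)}\log\hat A^z_{z^{(t)},j}+(1-G_j^{(t)})\log(1-\hat A^z_{z^{(t)},j}),\qquad 0\log0=0.$$ An assignment is feasible if $G^{(t)}_{z^{(t)}}=1$ for every $t$ (the assigned hub appears in its group). $\hat z$ is a maximizer of $L_G(z)$ over feasible assignments, and $\hat A^{\hat z}$ is $\hat A^z$ at $z=\hat z$. Asymptotics: $n_L,n,T,\rho,A,d,v$ all vary along a sequence; $o(1)$ and $o_p(1)$ are along this sequence, and "constant" means independent of the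 sequence index. Standing assumption: $\min_i\rho_i=c_{\min*}/n_L$ and $\max_i\rho_i=c_{\max*}/n_L$ with positive constants $c_{\min*},c_{\max*}$. *)

theory Defs
  imports "HOL-Probability.Probability" "HOL-Probability.Product_PMF"
begin

(* Nodes are 1..n, possible hubs 1..nL, groups 1..T.  The vector rho is a pmf on nat supported
   in {1..nL}; values A i j outside {1..nL} x {1..n} are irrelevant. *)

definition hub_params :: "nat \<Rightarrow> nat \<Rightarrow> nat pmf \<Rightarrow> (nat \<Rightarrow> nat \<Rightarrow> real) \<Rightarrow> bool" where
  "hub_params nL n \<rho> A \<longleftrightarrow>
     nL \<le> n \<and> set_pmf \<rho> \<subseteq> {1..nL} \<and>
     (\<forall>i\<in>{1..nL}. \<forall>j\<in>{1..n}. 0 \<le> A i j \<and> A i j \<le> 1) \<and>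
     (\<forall>i\<in>{1..nL}. A i i = 1)"

definition group_pmf :: "nat \<Rightarrow> (nat \<Rightarrow> real) \<Rightarrow> (nat \<Rightarrow> bool) pmf" where
  "group_pmf n a = Pi_pmf {1..n} False (\<lambda>j. bernoulli_pmf (a j))"

definition hub_group_pmf ::
    "nat \<Rightarrow> nat pmf \<Rightarrow> (nat \<Rightarrow> nat \<Rightarrow> real) \<Rightarrow> (nat \<times> (nat \<Rightarrow> bool)) pmf" where
  "hub_group_pmf n \<rho> A = bind_pmf \<rho> (\<lambda>i. map_pmf (\<lambda>g. (i, g)) (group_pmf n (A i)))"

definition hub_model_pmf ::
    "nat \<Rightarrow> nat \<Rightarrow> nat pmf \<Rightarrow> (nat \<Rightarrow> nat \<Rightarrow> real) \<Rightarrow> (nat \<Rightarrow> nat \<times> (nat \<Rightarrow> bool)) pmf" where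
  "hub_model_pmf n T \<rho> A = Pi_pmf {1..T} (0, \<lambda>_. False) (\<lambda>_. hub_group_pmf n \<rho> A)"

(* The observed part of an outcome: observed \<omega> t j says that node j appears in group t. *)
definition observed :: "(nat \<Rightarrow> nat \<times> (nat \<Rightarrow> bool)) \<Rightarrow> nat \<Rightarrow> nat \<Rightarrow> bool" where
  "observed \<omega> = (\<lambda>t. snd (\<omega> t))"

(* Equals 0 if no group is assigned to i, since x / 0 = 0. *)
definition A_hat :: "nat \<Rightarrow> (nat \<Rightarrow> nat \<Rightarrow> bool) \<Rightarrow> (nat \<Rightarrow> nat) \<Rightarrow> nat \<Rightarrow> nat \<Rightarrow> real" where
  "A_hat T G z i j =
     (\<Sum>t=1..T. of_bool (G t j) * of_bool (z t = i)) / (\<Sum>t=1..T. of_bool (z t = i))"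

(* Here ln 0 = 0, but ln 0 only ever occurs with coefficient 0:  for i = z t, A_hat T G z i j > 0
   if G t j and A_hat T G z i j < 1 if not. *)
definition profile_loglik ::
    "nat \<Rightarrow> nat \<Rightarrow> (nat \<Rightarrow> nat \<Rightarrow> bool) \<Rightarrow> (nat \<Rightarrow> nat) \<Rightarrow> real" where
  "profile_loglik n T G z =
     (\<Sum>t=1..T. \<Sum>j=1..n.
        of_bool (G t j) * ln (A_hat T G z (z t) j) +
        (1 - of_bool (G t j)) * ln (1 - A_hat T G z (z t) j))"

definition feasible :: "nat \<Rightarrow> nat \<Rightarrow> (nat \<Rightarrow> nat \<Rightarrow> bool) \<Rightarrow> (nat \<Rightarrow> nat) \<Rightarrow> bool" where
  "feasible nL T G z \<longleftrightarrow> (\<forall>t\<in>{1..T}. z t \<in> {1..nL} \<and> G t (z t))"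

(* Feasible assignments exist almost surely in the model because A i i = 1; on data
   without any, nothing is required of the estimator. *)
definition profile_estimator ::
    "nat \<Rightarrow> nat \<Rightarrow> nat \<Rightarrow> ((nat \<Rightarrow> nat \<Rightarrow> bool) \<Rightarrow> nat \<Rightarrow> nat) \<Rightarrow> bool" where
  "profile_estimator nL n T zhat \<longleftrightarrow>
     (\<forall>G. (\<exists>z. feasible nL T G z) \<longrightarrow>
          is_arg_max (profile_loglik n T G) (feasible nL T G) (zhat G))"

(* X m is o_p(1) under the laws P m, which may live on a different space for each m. *)
definition small_o_prob :: "(nat \<Rightarrow> 'a pmf) \<Rightarrow> (nat \<Rightarrow> 'a \<Rightarrow> real) \<Rightarrow> bool" where
  "small_o_prob P X \<longleftrightarrow>
     (\<forall>\<epsilon>>0. (\<lambda>m. measure_pmf.prob (P m) {\<omega>. \<bar>X m \<omega>\<bar> > \<epsilon>}) \<longlonglongrightarrow> 0)"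

end

theory Submission
  imports Defs
begin

text \<open>
  Fix an assignment \<open>z\<close> and a matrix \<open>B\<close>. Given the true assignment \<open>z\<^sub>*\<close>, the square root of the
  likelihood ratio of \<open>(z, B)\<close> against the truth has expectation at most \<open>exp (- S / 2)\<close>, where \<open>S\<close> is the sum over
  \<open>t, j\<close> of \<open>(A (z\<^sub>* t) j - B (z t) j)\<^sup>2\<close>. The matrices \<open>A_hat\<close> take only finitely many values,
  so a union bound over all \<open>(z, B)\<close> applies, and since the estimator beats the truth in
  likelihood, \<open>S\<close> is small at \<open>z = zhat\<close> with high probability. No logarithm of a small
  probability ever has to be controlled.

  By the separation condition, a small \<open>S\<close> means that every true hub \<open>i\<close> either fills almost all
  or almost none of each estimated class. Suppose that \<open>i\<close> dominates a class \<open>l \<noteq> i\<close>. By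
  feasibility and sparsity \<open>i\<close> puts at most order \<open>T / nL\<^sup>2\<close> groups there, so \<open>l\<close> keeps almost
  nothing of its own class and, being subject to the same bound, has to dominate order \<open>nL\<close>
  other classes. Each of these robs another hub of its class, which then dominates order \<open>nL\<close>
  classes as well; this gives order \<open>nL\<^sup>2\<close> distinct classes out of \<open>nL\<close>, a contradiction.
  Hence almost all groups are assigned correctly, uniformly over the hubs, and the estimates
  inherit the concentration of the frequencies under the true assignment.
\<close>

subsection \<open>Exponential moment bounds in the hub model\<close>

lemma finite_set_Pi_pmf:
  assumes "finite I" "\<And>t. t \<in> I \<Longrightarrow> finite (set_pmf (p t))"
  shows "finite (set_pmf (Pi_pmf I dflt p))"
  using assms by (auto simp: set_Pi_pmf intro!: finite_PiE_dflt)

text \<open>Markov's inequality, with the expectation of the product factorised by independence.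
  Finite supports take care of integrability. Every tail bound below reduces to this form.\<close>

lemma prob_prod_Pi_pmf_ge:
  fixes f :: "'i \<Rightarrow> 'a \<Rightarrow> real"
  assumes I: "finite I" and p: "\<And>t. t \<in> I \<Longrightarrow> finite (set_pmf (p t))"
    and f0: "\<And>t x. t \<in> I \<Longrightarrow> 0 \<le> f t x"
    and fc: "\<And>t. t \<in> I \<Longrightarrow> measure_pmf.expectation (p t) (f t) \<le> c t"
    and M: "M > 0"
  shows "measure_pmf.prob (Pi_pmf I dflt p) {\<omega>. M \<le> (\<Prod>t\<in>I. f t (\<omega> t))} \<le> (\<Prod>t\<in>I. c t) / M"
proof -
  have "measure_pmf.prob (Pi_pmf I dflt p) {\<omega>. M \<le> (\<Prod>t\<in>I. f t (\<omega> t))}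
      \<le> measure_pmf.expectation (Pi_pmf I dflt p) (\<lambda>\<omega>. \<Prod>t\<in>I. f t (\<omega> t)) / M"
    using integral_Markov_inequality_measure[of "measure_pmf (Pi_pmf I dflt p)"
        "\<lambda>\<omega>. \<Prod>t\<in>I. f t (\<omega> t)" UNIV M] M f0
    by (auto intro!: integrable_measure_pmf_finite finite_set_Pi_pmf I p prod_nonneg)
  also have "measure_pmf.expectation (Pi_pmf I dflt p) (\<lambda>\<omega>. \<Prod>t\<in>I. f t (\<omega> t)) =
      (\<Prod>t\<in>I. measure_pmf.expectation (p t) (f t))"
    using I p f0 by (intro expectation_prod_Pi_pmf integrable_measure_pmf_finite)
  also have "\<dots> \<le> (\<Prod>t\<in>I. c t)"
    using f0 fc by (intro prod_mono) (auto intro!: integral_nonneg_AE)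
  finally show ?thesis
    using M by (simp add: divide_right_mono)
qed

lemma finite_set_group_pmf: "finite (set_pmf (group_pmf n a))"
  unfolding group_pmf_def by (intro finite_set_Pi_pmf) auto

lemma finite_set_hub_group_pmf:
  assumes "finite (set_pmf \<rho>)"
  shows "finite (set_pmf (hub_group_pmf n \<rho> A))"
  using assms finite_set_group_pmf by (auto simp: hub_group_pmf_def)

lemma expectation_hub_group_pmf:
  fixes f :: "nat \<times> (nat \<Rightarrow> bool) \<Rightarrow> real"
  assumes "finite L" "set_pmf \<rho> \<subseteq> L"
  shows "measure_pmf.expectation (hub_group_pmf n \<rho> A) f =
    (\<Sum>i\<in>L. pmf \<rho> i * measure_pmf.expectation (group_pmf n (A i)) (\<lambda>g. f (i, g)))"
  unfolding hub_group_pmf_def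
  by (subst pmf_expectation_bind[OF assms(1) _ assms(2)]) (auto simp: finite_set_group_pmf)

lemma expectation_group_pmf_component:
  fixes h :: "bool \<Rightarrow> real"
  assumes "j \<in> {1..n}" "0 \<le> a j" "a j \<le> 1"
  shows "measure_pmf.expectation (group_pmf n a) (\<lambda>g. h (g j)) = a j * h True + (1 - a j) * h False"
proof -
  have "measure_pmf.expectation (group_pmf n a) (\<lambda>g. h (g j)) =
      measure_pmf.expectation (map_pmf (\<lambda>g. g j) (group_pmf n a)) h"
    by simp
  also have "map_pmf (\<lambda>g. g j) (group_pmf n a) = bernoulli_pmf (a j)"
    using assms unfolding group_pmf_def by (subst Pi_pmf_component) auto
  finally show ?thesis using assms by simp
qed

text \<open>Chernoff bound in which only the groups of hub \<open>i\<close> contribute. One group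
  has exponential moment \<open>1 + pmf \<rho> i * (E exp Y - 1)\<close>, so the hub probability
  enters the exponent as a factor. The choices of \<open>Y\<close> made later are the constant -1,
  an indicator and a scaled centred indicator.\<close>

lemma prob_hub_count_ge:
  fixes Y :: "(nat \<Rightarrow> bool) \<Rightarrow> real"
  assumes L: "finite L" "set_pmf \<rho> \<subseteq> L" and i: "i \<in> L"
    and Y: "measure_pmf.expectation (group_pmf n (A i)) (\<lambda>g. exp (Y g)) \<le> 1 + u"
  shows "measure_pmf.prob (hub_model_pmf n T \<rho> A)
      {\<omega>. a \<le> (\<Sum>t=1..T. of_bool (fst (\<omega> t) = i) * Y (snd (\<omega> t)))}
    \<le> exp (real T * pmf \<rho> i * u - a)"
proof -
  have fin: "finite (set_pmf (hub_group_pmf n \<rho> A))"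
    using L by (intro finite_set_hub_group_pmf) (rule finite_subset)
  define F where "F = (\<lambda>x::nat \<times> (nat \<Rightarrow> bool). exp (of_bool (fst x = i) * Y (snd x)))"
  have "measure_pmf.expectation (hub_group_pmf n \<rho> A) F =
      (\<Sum>k\<in>L. pmf \<rho> k * measure_pmf.expectation (group_pmf n (A k)) (\<lambda>g. F (k, g)))"
    by (rule expectation_hub_group_pmf[OF L])
  \<comment> \<open>For \<open>k\<close> different from \<open>i\<close> the exponent is 0 and the
    integrand is 1, so only the term \<open>k = i\<close> deviates from
    \<open>pmf \<rho> k\<close>.\<close>
  also have "\<dots> = (\<Sum>k\<in>L. pmf \<rho> k + (if k = i then
      pmf \<rho> i * (measure_pmf.expectation (group_pmf n (A i)) (\<lambda>g. exp (Y g)) - 1) else 0))"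
    by (intro sum.cong) (auto simp: F_def algebra_simps)
  also have "\<dots> = 1 + pmf \<rho> i * (measure_pmf.expectation (group_pmf n (A i)) (\<lambda>g. exp (Y g)) - 1)"
    using L i by (simp add: sum.distrib sum_pmf_eq_1)
  also have "\<dots> \<le> 1 + pmf \<rho> i * u"
    using Y by (intro add_left_mono mult_left_mono) auto
  also have "\<dots> \<le> exp (pmf \<rho> i * u)"
    by (simp add: exp_ge_add_one_self add.commute)
  finally have F: "measure_pmf.expectation (hub_group_pmf n \<rho> A) F \<le> exp (pmf \<rho> i * u)" .
  have "{\<omega>. a \<le> (\<Sum>t=1..T. of_bool (fst (\<omega> t) = i) * Y (snd (\<omega> t)))} =
      {\<omega>. exp a \<le> (\<Prod>t=1..T. F (\<omega> t))}"
    by (simp add: F_def exp_sum[symmetric])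
  then have "measure_pmf.prob (hub_model_pmf n T \<rho> A)
      {\<omega>. a \<le> (\<Sum>t=1..T. of_bool (fst (\<omega> t) = i) * Y (snd (\<omega> t)))} \<le>
      (\<Prod>t=1..T. exp (pmf \<rho> i * u)) / exp a"
    unfolding hub_model_pmf_def
    using F fin by (simp only:, intro prob_prod_Pi_pmf_ge) (auto simp: F_def)
  then show ?thesis
    by (simp add: exp_diff exp_of_nat_mult[symmetric] mult.assoc)
qed

text \<open>For negative \<open>x = - y\<close> it suffices that
  \<open>(1 - y + y^2) * exp y\<close> is at least 1, and the quadratic Taylor minorant of
  \<open>exp y\<close> is already enough for this.\<close>

lemma exp_quadratic_bound:
  fixes x :: real
  assumes "\<bar>x\<bar> \<le> 1"
  shows "exp x \<le> 1 + x + x\<^sup>2"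
proof (cases "x \<ge> 0")
  case True
  then show ?thesis using assms exp_bound by auto
next
  case False
  define y where "y = - x"
  have y: "0 \<le> y" "y \<le> 1" using False assms by (auto simp: y_def)
  have "1 \<le> (1 - y + y\<^sup>2) * (1 + y + y\<^sup>2 / 2)"
  proof -
    have "(1 - y + y\<^sup>2) * (1 + y + y\<^sup>2 / 2) - 1 = y^2 * (1 + y + y^2) / 2"
      by (simp add: field_simps power2_eq_square)
    also have "\<dots> \<ge> 0" using y by simp
    finally show ?thesis by simp
  qed
  also have "\<dots> \<le> (1 - y + y\<^sup>2) * exp y"
    using y exp_lower_Taylor_quadratic[of y] by (intro mult_left_mono) auto
  finally have "exp (- y) \<le> 1 - y + y\<^sup>2"
    by (simp add: exp_minus field_simps)
  then show ?thesis by (simp add: y_def)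
qed

text \<open>The mixed term of the squared affinity is at most
  \<open>a * (1 - a) + b * (1 - b)\<close> by the arithmetic-geometric mean inequality. This leaves
  \<open>1 - (a - b)^2\<close>, which is at most \<open>exp (- (a - b)^2)\<close>.\<close>

lemma bernoulli_affinity_le:
  fixes a b :: real
  assumes "0 \<le> a" "a \<le> 1" "0 \<le> b" "b \<le> 1"
  shows "sqrt (a * b) + sqrt ((1 - a) * (1 - b)) \<le> exp (- ((a - b)\<^sup>2 / 2))"
proof -
  have "(sqrt (a * b) + sqrt ((1 - a) * (1 - b)))\<^sup>2 =
      a * b + (1 - a) * (1 - b) + 2 * (sqrt (a * (1 - a)) * sqrt (b * (1 - b)))"
  proof -
    have "sqrt (a * b) * sqrt ((1 - a) * (1 - b)) = sqrt (a * (1 - a)) * sqrt (b * (1 - b))"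
      by (simp add: real_sqrt_mult)
    moreover have "(sqrt (a * b))\<^sup>2 = a * b" "(sqrt ((1 - a) * (1 - b)))\<^sup>2 = (1 - a) * (1 - b)"
      using assms by simp_all
    ultimately show ?thesis by (simp only: power2_sum mult.assoc)
  qed
  also have "\<dots> \<le> a * b + (1 - a) * (1 - b) + (a * (1 - a) + b * (1 - b))"
    using sum_squares_bound[of "sqrt (a * (1 - a))" "sqrt (b * (1 - b))"] assms
    by (simp add: mult.assoc)
  also have "\<dots> = 1 - (a - b)\<^sup>2" by (simp add: power2_eq_square algebra_simps)
  also have "\<dots> \<le> exp (- ((a - b)\<^sup>2))" using exp_ge_add_one_self[of "- ((a - b)\<^sup>2)"] by simp
  also have "\<dots> = (exp (- ((a - b)\<^sup>2 / 2)))\<^sup>2"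
    by (simp add: exp_of_nat_mult[symmetric])
  finally show ?thesis by (rule power2_le_imp_le) simp
qed

text \<open>The exponential factor compensates the Hellinger affinity, so that the expectation is at
  most 1. Outcomes of probability 0 under \<open>a\<close> give the value 0, since \<open>x / 0 = 0\<close>.\<close>

definition lik_ratio :: "real \<Rightarrow> real \<Rightarrow> bool \<Rightarrow> real" where
  "lik_ratio a b x =
     sqrt (pmf (bernoulli_pmf b) x / pmf (bernoulli_pmf a) x) * exp ((a - b)\<^sup>2 / 2)"

lemma lik_ratio_nonneg: "0 \<le> lik_ratio a b x"
  by (simp add: lik_ratio_def)

lemma expectation_lik_ratio_le:
  assumes "0 \<le> a" "a \<le> 1" "0 \<le> b" "b \<le> 1"
  shows "measure_pmf.expectation (bernoulli_pmf a) (lik_ratio a b) \<le> 1"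
proof -
  \<comment> \<open>This includes \<open>x = 0\<close>, where both sides vanish, so degenerate
    parameters \<open>a\<close> need no separate treatment.\<close>
  have *: "x * sqrt (y / x) = sqrt (x * y)" if "0 \<le> x" "0 \<le> y" for x y :: real
    using that by (cases "x = 0") (auto simp: real_sqrt_mult real_sqrt_divide field_simps)
  have "measure_pmf.expectation (bernoulli_pmf a) (lik_ratio a b) =
     (a * sqrt (b / a) + (1 - a) * sqrt ((1 - b) / (1 - a))) * exp ((a - b)\<^sup>2 / 2)"
    using assms by (simp add: lik_ratio_def algebra_simps)
  also have "\<dots> = (sqrt (a * b) + sqrt ((1 - a) * (1 - b))) * exp ((a - b)\<^sup>2 / 2)"
    using assms by (simp add: *)
  also have "\<dots> \<le> exp (- ((a - b)\<^sup>2 / 2)) * exp ((a - b)\<^sup>2 / 2)"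
    using bernoulli_affinity_le[OF assms] by (intro mult_right_mono) auto
  finally show ?thesis by (simp add: exp_minus)
qed

text \<open>Given any true hub, the nodes are independent and each factor has expectation at most 1;
  averaging over the hubs preserves this bound. The matrix \<open>B\<close> must not depend on the
  data, which is why a union bound over its values follows later.\<close>

lemma prob_lik_ratio_ge:
  assumes L: "finite L" "set_pmf \<rho> \<subseteq> L"
    and A: "\<And>i j. i \<in> L \<Longrightarrow> j \<in> {1..n} \<Longrightarrow> 0 \<le> A i j \<and> A i j \<le> 1"
    and B: "\<And>t j. t \<in> {1..T} \<Longrightarrow> j \<in> {1..n} \<Longrightarrow> 0 \<le> B t j \<and> B t j \<le> 1"
    and M: "M > 0"
  shows "measure_pmf.prob (hub_model_pmf n T \<rho> A)
      {\<omega>. M \<le> (\<Prod>t=1..T. \<Prod>j=1..n. lik_ratio (A (fst (\<omega> t)) j) (B t j) (snd (\<omega> t) j))} \<le> 1 / M"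
proof -
  have fin: "finite (set_pmf (hub_group_pmf n \<rho> A))"
    using L by (intro finite_set_hub_group_pmf) (rule finite_subset)
  define F where "F = (\<lambda>t x. \<Prod>j=1..n. lik_ratio (A (fst x) j) (B t j) (snd x j))"
  have "measure_pmf.expectation (hub_group_pmf n \<rho> A) (F t) \<le> 1" if t: "t \<in> {1..T}" for t
  proof -
    have "measure_pmf.expectation (group_pmf n (A i)) (\<lambda>g. F t (i, g)) \<le> 1" if i: "i \<in> L" for i
    proof -
      have "measure_pmf.expectation (group_pmf n (A i)) (\<lambda>g. F t (i, g)) =
          (\<Prod>j=1..n. measure_pmf.expectation (bernoulli_pmf (A i j)) (lik_ratio (A i j) (B t j)))"
        unfolding group_pmf_def F_def fst_conv snd_conv
        by (rule expectation_prod_Pi_pmf)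
          (auto simp: lik_ratio_nonneg intro!: integrable_measure_pmf_finite)
      also have "\<dots> \<le> 1"
        using A B i t 
        by (intro prod_le_1 conjI expectation_lik_ratio_le integral_nonneg_AE)
          (auto simp: lik_ratio_nonneg)
      finally show ?thesis .
    qed
    then have "measure_pmf.expectation (hub_group_pmf n \<rho> A) (F t) \<le> (\<Sum>i\<in>L. pmf \<rho> i * 1)"
      unfolding expectation_hub_group_pmf[OF L] by (intro sum_mono mult_left_mono) auto
    then show ?thesis using L by (simp add: sum_pmf_eq_1)
  qed
  then have "measure_pmf.prob (hub_model_pmf n T \<rho> A) {\<omega>. M \<le> (\<Prod>t=1..T. F t (\<omega> t))}
      \<le> (\<Prod>t=1..T. 1) / M"
    unfolding hub_model_pmf_def using M fin
    by (intro prob_prod_Pi_pmf_ge) (auto simp: F_def lik_ratio_nonneg prod_nonneg)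
  then show ?thesis by (simp add: F_def)
qed

subsection \<open>From mean square fit to correct assignment\<close>

text \<open>In the application \<open>t i k\<close> counts the groups of hub \<open>i\<close> in
  class \<open>k\<close>, and \<open>r i k\<close> the other groups of that class. The last part of
  \<open>sep\<close> says that two successive rounds of domination would need more disjoint classes
  than \<open>L\<close> has elements.\<close>

lemma label_dominance:
  fixes t r :: "'a \<Rightarrow> 'a \<Rightarrow> real"
  assumes L: "finite L"
    and t0: "\<And>i k. i \<in> L \<Longrightarrow> k \<in> L \<Longrightarrow> 0 \<le> t i k"
    and r0: "\<And>i k. i \<in> L \<Longrightarrow> k \<in> L \<Longrightarrow> 0 \<le> r i k"
    and tr: "\<And>i i' k. i \<in> L \<Longrightarrow> i' \<in> L \<Longrightarrow> i \<noteq> i' \<Longrightarrow> k \<in> L \<Longrightarrow> t i k \<le> r i' k"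
    and e: "\<And>i. i \<in> L \<Longrightarrow> (\<Sum>k\<in>L. min (t i k) (r i k)) \<le> e"
    and b: "\<And>i k. i \<in> L \<Longrightarrow> k \<in> L \<Longrightarrow> i \<noteq> k \<Longrightarrow> t i k \<le> b"
    and s: "\<And>i. i \<in> L \<Longrightarrow> s \<le> (\<Sum>k\<in>L. t i k)"
    and sep: "2 * e < s" "e + b < s" "real (card L) * b\<^sup>2 < (s - e - b)\<^sup>2"
    and i: "i \<in> L"
  shows "(\<Sum>k\<in>L - {i}. t i k) \<le> e" "r i i \<le> e"
proof -
  \<comment> \<open>These are the foreign classes in which \<open>i\<close> has a strict majority.
    Everywhere else \<open>t i k\<close> is itself the minimum and is charged to
    \<open>e\<close>.\<close>
  define D where "D = (\<lambda>i. {k \<in> L - {i}. r i k < t i k})"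
  have finD: "finite (D i)" for i using L by (simp add: D_def)
  have off_diag: "(\<Sum>k\<in>L - {i}. t i k) \<le> e + b * card (D i)" if i: "i \<in> L" for i
  proof -
    have "(\<Sum>k\<in>L - {i}. t i k) \<le> (\<Sum>k\<in>L - {i}. min (t i k) (r i k) + (if k \<in> D i then b else 0))"
    proof (intro sum_mono)
      fix k assume "k \<in> L - {i}"
      then show "t i k \<le> min (t i k) (r i k) + (if k \<in> D i then b else 0)"
        using b[of i k] r0[of i k] i by (auto simp: D_def min_def)
    qed
    also have "\<dots> = (\<Sum>k\<in>L - {i}. min (t i k) (r i k)) + b * card (D i)"
    proof -
      have "(L - {i}) \<inter> D i = D i" by (auto simp: D_def)
      then show ?thesis using L by (simp add: sum.distrib sum.inter_restrict[symmetric])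
    qed
    also have "(\<Sum>k\<in>L - {i}. min (t i k) (r i k)) \<le> (\<Sum>k\<in>L. min (t i k) (r i k))"
      using L t0 r0 i by (intro sum_mono2) auto
    also have "\<dots> \<le> e" using e i by blast
    finally show ?thesis by simp
  qed
  \<comment> \<open>If \<open>i\<close> dominates class \<open>l\<close>, then
    \<open>t l l \<le> r i l < t i l \<le> b\<close>. So \<open>l\<close> has at least
    \<open>s - b\<close> groups outside its own class, and all but \<open>e\<close> of them lie in
    classes dominated by \<open>l\<close>, at most \<open>b\<close> in each.\<close>
  have big: "s - e - b \<le> b * card (D l)" if i: "i \<in> L" and l: "l \<in> D i" for i l
  proof -
    have l': "l \<in> L" "l \<noteq> i" using l by (auto simp: D_def)
    have "t l l \<le> r i l" using tr i l' by blast
    also have "\<dots> \<le> b" using l b[of i l] i by (auto simp: D_def)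
    finally have "t l l \<le> b" .
    moreover have "(\<Sum>k\<in>L. t l k) = t l l + (\<Sum>k\<in>L - {l}. t l k)"
      using L l' by (simp add: sum.remove)
    ultimately show ?thesis using s[of l] off_diag[of l] l' by linarith
  qed
  \<comment> \<open>Two strict majorities in one class would give the cycle
    \<open>t i k \<le> r i' k < t i' k \<le> r i k < t i k\<close>.\<close>
  have disj: "D i \<inter> D i' = {}" if "i \<in> L" "i' \<in> L" "i \<noteq> i'" for i i'
  proof -
    have False if "k \<in> D i" "k \<in> D i'" for k
      using tr[of i i' k] tr[of i' i k] that \<open>i \<in> L\<close> \<open>i' \<in> L\<close> \<open>i \<noteq> i'\<close> by (auto simp: D_def)
    then show ?thesis by blast
  qed
  have empty: "D i = {}" if i: "i \<in> L" for i
  proof (rule ccontr)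
    assume "D i \<noteq> {}"
    then obtain l where l: "l \<in> D i" by blast
    have lL: "l \<in> L" using l by (simp add: D_def)
    have b0: "0 \<le> b" using t0[of i l] b[of i l] l i by (auto simp: D_def)
    have DL: "D l \<subseteq> L" by (auto simp: D_def)
    \<comment> \<open>The bound \<open>big\<close> is used twice: for \<open>l\<close>, and then for
      every \<open>l'\<close> in \<open>D l\<close>, whose own class is dominated by
      \<open>l\<close>. The sets \<open>D l'\<close> are disjoint subsets of
      \<open>L\<close>.\<close>
    have "(s - e - b)\<^sup>2 \<le> b * card (D l) * (s - e - b)"
      unfolding power2_eq_square using big[OF i l] sep by (intro mult_right_mono) auto
    also have "\<dots> = b * (\<Sum>l'\<in>D l. s - e - b)" by simp
    also have "\<dots> \<le> b * (\<Sum>l'\<in>D l. b * card (D l'))"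
      using big[OF lL] b0 by (intro mult_left_mono sum_mono) auto
    also have "\<dots> = b\<^sup>2 * (\<Sum>l'\<in>D l. card (D l'))"
      by (simp add: sum_distrib_left power2_eq_square mult.assoc)
    also have "(\<Sum>l'\<in>D l. card (D l')) = card (\<Union>l'\<in>D l. D l')"
      using disj DL finD by (subst card_UN_disjoint) auto
    also have "b\<^sup>2 * card (\<Union>l'\<in>D l. D l') \<le> b\<^sup>2 * card L"
      using L by (intro mult_left_mono of_nat_mono card_mono) (auto simp: D_def)
    finally show False using sep by (simp add: mult.commute)
  qed
  show off: "(\<Sum>k\<in>L - {i}. t i k) \<le> e"
    using off_diag[OF i] empty[OF i] by simp
  have "s - e \<le> t i i"
    using s[OF i] off L i by (simp add: sum.remove)
  \<comment> \<open>Since \<open>t i i\<close> is at least \<open>s - e\<close>, hence larger than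
    \<open>e\<close>, the minimum on the diagonal has to be \<open>r i i\<close>.\<close>
  moreover have "min (t i i) (r i i) \<le> (\<Sum>k\<in>L. min (t i k) (r i k))"
    using L i t0 r0 by (intro member_le_sum) auto
  ultimately show "r i i \<le> e"
    using e[OF i] sep by (auto simp: min_def split: if_splits)
qed

text \<open>A single number \<open>c\<close> lies at distance at least \<open>d / 2\<close> from one
  of the two separated sides, so every point of that side costs \<open>d^2 / 4\<close>. Which side
  it is depends on the position of \<open>c\<close> relative to the midpoint
  \<open>a - d / 2\<close>.\<close>

lemma separated_sum_squares_ge:
  fixes x :: "'a \<Rightarrow> real"
  assumes S: "finite S" and d: "0 \<le> d"
    and in_P: "\<And>t. t \<in> S \<Longrightarrow> P t \<Longrightarrow> x t = a"
    and not_P: "\<And>t. t \<in> S \<Longrightarrow> \<not> P t \<Longrightarrow> x t \<le> a - d"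
  shows "d\<^sup>2 / 4 * min (real (card {t\<in>S. P t})) (real (card {t\<in>S. \<not> P t})) \<le> (\<Sum>t\<in>S. (x t - c)\<^sup>2)"
proof -
  have *: "d\<^sup>2 / 4 * real (card {t\<in>S. Q t}) \<le> (\<Sum>t\<in>S. (x t - c)\<^sup>2)"
    if Q: "\<And>t. t \<in> S \<Longrightarrow> Q t \<Longrightarrow> d / 2 \<le> \<bar>x t - c\<bar>" for Q
  proof -
    have "d\<^sup>2 / 4 * real (card {t\<in>S. Q t}) = (\<Sum>t\<in>{t\<in>S. Q t}. (d / 2)\<^sup>2)"
      by (simp add: power2_eq_square)
    also have "\<dots> \<le> (\<Sum>t\<in>{t\<in>S. Q t}. (x t - c)\<^sup>2)"
      using Q d by (intro sum_mono) (metis (no_types, lifting) abs_le_square_iff abs_of_nonneg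
          divide_nonneg_pos mem_Collect_eq zero_less_numeral)
    also have "\<dots> \<le> (\<Sum>t\<in>S. (x t - c)\<^sup>2)"
      using S by (intro sum_mono2) auto
    finally show ?thesis .
  qed
  show ?thesis
  proof (cases "c < a - d / 2")
    case True
    then have "d\<^sup>2 / 4 * real (card {t\<in>S. P t}) \<le> (\<Sum>t\<in>S. (x t - c)\<^sup>2)"
      using in_P d by (intro *) (auto simp: abs_if)
    then show ?thesis
      by (smt (verit) mult_left_mono zero_le_power2 divide_nonneg_pos)
  next
    case False
    then have "d\<^sup>2 / 4 * real (card {t\<in>S. \<not> P t}) \<le> (\<Sum>t\<in>S. (x t - c)\<^sup>2)"
      using not_P d by (intro *) (fastforce simp: abs_if)
    then show ?thesis
      by (smt (verit) mult_left_mono zero_le_power2 divide_nonneg_pos)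
  qed
qed

text \<open>Within a class \<open>B (z t) j\<close> is constant in \<open>t\<close>, while for
  \<open>j\<close> in \<open>V\<close> the values \<open>A (zs t) j\<close> of hub \<open>i\<close>
  are separated from those of all other hubs. A class that mixes them therefore pays in each column
  of \<open>V\<close>, in proportion to its minority.\<close>

lemma sum_min_count_le:
  fixes A B :: "nat \<Rightarrow> nat \<Rightarrow> real" and T n :: nat
  assumes L: "finite L" and z: "\<And>t. t \<in> {1..T} \<Longrightarrow> z t \<in> L" and zs: "\<And>t. t \<in> {1..T} \<Longrightarrow> zs t \<in> L"
    and V: "V \<subseteq> {1..n}" and d: "0 \<le> d"
    and gap: "\<And>j i'. j \<in> V \<Longrightarrow> i' \<in> L \<Longrightarrow> i' \<noteq> i \<Longrightarrow> A i j - A i' j \<ge> d"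
  shows "d\<^sup>2 / 4 * real (card V) * (\<Sum>k\<in>L. min (real (card {t\<in>{1..T}. z t = k \<and> zs t = i}))
           (real (card {t\<in>{1..T}. z t = k \<and> zs t \<noteq> i})))
    \<le> (\<Sum>t=1..T. \<Sum>j=1..n. (A (zs t) j - B (z t) j)\<^sup>2)"
proof -
  define m where "m = (\<lambda>k. min (real (card {t\<in>{1..T}. z t = k \<and> zs t = i}))
           (real (card {t\<in>{1..T}. z t = k \<and> zs t \<noteq> i})))"
  have cell: "d\<^sup>2 / 4 * m k \<le> (\<Sum>t\<in>{t\<in>{1..T}. z t = k}. (A (zs t) j - B (z t) j)\<^sup>2)"
    if j: "j \<in> V" for j k
  proof -
    have "d\<^sup>2 / 4 * min (real (card {t\<in>{t\<in>{1..T}. z t = k}. zs t = i}))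
        (real (card {t\<in>{t\<in>{1..T}. z t = k}. \<not> zs t = i}))
      \<le> (\<Sum>t\<in>{t\<in>{1..T}. z t = k}. (A (zs t) j - B k j)\<^sup>2)"
    proof (rule separated_sum_squares_ge[where a = "A i j"])
      show "finite {t\<in>{1..T}. z t = k}" by simp
      show "A (zs t) j \<le> A i j - d" if "t \<in> {t\<in>{1..T}. z t = k}" "zs t \<noteq> i" for t
        using gap[OF j, of "zs t"] zs[of t] that by auto
    qed (use d in auto)
    also have "\<dots> = (\<Sum>t\<in>{t\<in>{1..T}. z t = k}. (A (zs t) j - B (z t) j)\<^sup>2)"
      by (intro sum.cong) auto
    finally show ?thesis by (simp add: m_def conj_assoc)
  qed
  have "d\<^sup>2 / 4 * real (card V) * (\<Sum>k\<in>L. m k) = (\<Sum>j\<in>V. d\<^sup>2 / 4 * (\<Sum>k\<in>L. m k))"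
    by simp
  also have "\<dots> = (\<Sum>j\<in>V. \<Sum>k\<in>L. d\<^sup>2 / 4 * m k)"
    by (simp only: sum_distrib_left)
  also have "\<dots> \<le> (\<Sum>j\<in>V. \<Sum>k\<in>L. \<Sum>t\<in>{t\<in>{1..T}. z t = k}. (A (zs t) j - B (z t) j)\<^sup>2)"
    using cell by (intro sum_mono)
  also have "\<dots> = (\<Sum>j\<in>V. \<Sum>t=1..T. (A (zs t) j - B (z t) j)\<^sup>2)"
    using L z by (intro sum.cong sum.group) auto
  also have "\<dots> \<le> (\<Sum>j=1..n. \<Sum>t=1..T. (A (zs t) j - B (z t) j)\<^sup>2)"
    using V by (intro sum_mono2) (auto intro: sum_nonneg)
  also have "\<dots> = (\<Sum>t=1..T. \<Sum>j=1..n. (A (zs t) j - B (z t) j)\<^sup>2)"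
    by (rule sum.swap)
  finally show ?thesis by (simp add: m_def)
qed

section \<open>Class frequencies and their distance from the true parameters\<close>

lemma A_hat_eq_card:
  "A_hat T G z i j = real (card {t\<in>{1..T}. z t = i \<and> G t j}) / real (card {t\<in>{1..T}. z t = i})"
proof -
  have "(\<Sum>t=1..T. of_bool (G t j) * of_bool (z t = i) :: real) = (\<Sum>t=1..T. of_bool (z t = i \<and> G t j))"
    by (intro sum.cong) auto
  then show ?thesis
    by (simp add: A_hat_def Int_def del: sum_of_bool_mult_eq)
qed

lemma A_hat_bounds: "0 \<le> A_hat T G z i j" "A_hat T G z i j \<le> 1"
proof -
  have "card {t\<in>{1..T}. z t = i \<and> G t j} \<le> card {t\<in>{1..T}. z t = i}"
    by (intro card_mono) auto
  then show "A_hat T G z i j \<le> 1" "0 \<le> A_hat T G z i j"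
    by (auto simp: A_hat_eq_card divide_le_eq_1)
qed

text \<open>The centred sum over the estimated class differs from the one over the true class only
  at groups wrongly included or lost. There are at most \<open>2 * e\<close> of these, each
  contributing at most 1, and the class keeps at least \<open>s - e\<close> members.\<close>

lemma A_hat_error_le:
  fixes A :: "nat \<Rightarrow> nat \<Rightarrow> real"
  assumes a: "0 \<le> A i j" "A i j \<le> 1"
    and mean: "\<bar>\<Sum>t=1..T. of_bool (zs t = i) * (of_bool (G t j) - A i j)\<bar> \<le> x"
    and e1: "real (card {t\<in>{1..T}. z t = i \<and> zs t \<noteq> i}) \<le> e"
    and e2: "real (card {t\<in>{1..T}. z t \<noteq> i \<and> zs t = i}) \<le> e"
    and s: "s \<le> real (card {t\<in>{1..T}. zs t = i})" "e < s"
  shows "\<bar>A_hat T G z i j - A i j\<bar> \<le> (x + 2 * e) / (s - e)"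
proof -
  define y where "y = (\<lambda>t. of_bool (G t j) - A i j)"
  have y1: "\<bar>y t\<bar> \<le> 1" for t using a by (auto simp: y_def)
  define c where "c = real (card {t\<in>{1..T}. z t = i})"
  have "{t\<in>{1..T}. zs t = i} \<subseteq> {t\<in>{1..T}. z t = i} \<union> {t\<in>{1..T}. z t \<noteq> i \<and> zs t = i}" by auto
  from order.trans[OF card_mono[OF _ this] card_Un_le] have "card {t\<in>{1..T}. zs t = i} \<le>
      card {t\<in>{1..T}. z t = i} + card {t\<in>{1..T}. z t \<noteq> i \<and> zs t = i}"
    by simp
  then have c: "s - e \<le> c" using e2 s by (simp add: c_def)
  have c0: "c > 0" using c s by simp
  have "A_hat T G z i j - A i j = (\<Sum>t=1..T. of_bool (z t = i) * y t) / c"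
  proof -
    have "(\<Sum>t=1..T. of_bool (z t = i) * y t) =
        (\<Sum>t=1..T. of_bool (G t j) * of_bool (z t = i)) - A i j * (\<Sum>t=1..T. of_bool (z t = i))"
      by (simp only: y_def right_diff_distrib sum_subtractf sum_distrib_left mult.commute)
    moreover have "(\<Sum>t=1..T. of_bool (z t = i)) = c" by (simp add: c_def Int_def)
    ultimately show ?thesis using c0 by (simp add: A_hat_def field_simps)
  qed
  also have "\<bar>\<dots>\<bar> = \<bar>\<Sum>t=1..T. of_bool (z t = i) * y t\<bar> / c" using c0 by simp
  also have "\<dots> \<le> (x + 2 * e) / (s - e)"
  proof (rule frac_le)
    have "\<bar>(\<Sum>t=1..T. of_bool (z t = i) * y t) - (\<Sum>t=1..T. of_bool (zs t = i) * y t)\<bar>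
        = \<bar>\<Sum>t=1..T. (of_bool (z t = i) - of_bool (zs t = i)) * y t\<bar>"
      by (simp only: sum_subtractf left_diff_distrib)
    also have "\<dots> \<le> (\<Sum>t=1..T. of_bool (z t = i \<and> zs t \<noteq> i) + of_bool (z t \<noteq> i \<and> zs t = i))"
      using y1 by (intro order.trans[OF sum_abs] sum_mono) auto
    also have "\<dots> = real (card {t\<in>{1..T}. z t = i \<and> zs t \<noteq> i}) + real (card {t\<in>{1..T}. z t \<noteq> i \<and> zs t = i})"
      by (simp add: sum.distrib Int_def)
    also have "\<dots> \<le> 2 * e" using e1 e2 by simp
    finally show "\<bar>\<Sum>t=1..T. of_bool (z t = i) * y t\<bar> \<le> x + 2 * e"
      using mean unfolding y_def by linarith
    show "0 \<le> x + 2 * e" using mean e1 by linarith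
  qed (use c s in auto)
  finally show ?thesis .
qed

subsection \<open>Likelihood ratios at the profile estimator\<close>

lemma pmf_bernoulli_eq:
  assumes "0 \<le> a" "a \<le> 1"
  shows "pmf (bernoulli_pmf a) x = (if x then a else 1 - a)"
  using assms by (cases x) auto

lemma profile_loglik_eq:
  "profile_loglik n T G z =
     (\<Sum>t=1..T. \<Sum>j=1..n. ln (pmf (bernoulli_pmf (A_hat T G z (z t) j)) (G t j)))"
  unfolding profile_loglik_def
  by (intro sum.cong) (auto simp: pmf_bernoulli_eq A_hat_bounds)

text \<open>Group \<open>t\<close> belongs to its own class, so the outcome observed there has
  positive frequency. Logarithms and quotients at the estimate thus never fall back on default
  values.\<close>

lemma pmf_A_hat_pos:
  assumes "t \<in> {1..T}"
  shows "0 < pmf (bernoulli_pmf (A_hat T G z (z t) j)) (G t j)"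
proof -
  let ?S = "{s\<in>{1..T}. z s = z t}" and ?S1 = "{s\<in>{1..T}. z s = z t \<and> G s j}"
  have sub: "?S1 \<subseteq> ?S" and t: "t \<in> ?S" using assms by auto
  have pos: "0 < card ?S" using t by (subst card_gt_0_iff) auto
  show ?thesis
  proof (cases "G t j")
    case True
    then have "0 < card ?S1" using t by (subst card_gt_0_iff) auto
    then show ?thesis using True pos by (simp add: pmf_bernoulli_eq A_hat_bounds) (simp add: A_hat_eq_card)
  next
    case False
    then have "card ?S1 < card ?S" using t sub by (intro psubset_card_mono) auto
    then show ?thesis using False pos by (simp add: pmf_bernoulli_eq A_hat_bounds) (simp add: A_hat_eq_card)
  qed
qed

text \<open>This is Gibbs' inequality without logarithms. As \<open>b\<close> is the empirical
  frequency in \<open>S\<close>, each outcome that occurs contributes \<open>card S\<close> times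
  its probability under \<open>a\<close>, and an outcome that does not occur contributes
  nothing.\<close>

lemma sum_lik_quotient_le:
  assumes S: "finite S" and a: "0 \<le> a" "a \<le> 1"
    and b: "b = real (card {t\<in>S. Q t}) / real (card S)"
  shows "(\<Sum>t\<in>S. pmf (bernoulli_pmf a) (Q t) / pmf (bernoulli_pmf b) (Q t)) \<le> real (card S)"
proof (cases "S = {}")
  case False
  define c c1 where "c = real (card S)" and "c1 = real (card {t\<in>S. Q t})"
  have c: "0 < c" using False S by (simp add: c_def card_gt_0_iff)
  have c1: "0 \<le> c1" "c1 \<le> c" using S by (auto simp: c_def c1_def intro: card_mono)
  have b01: "0 \<le> b" "b \<le> 1" using b c c1 by (auto simp: c_def c1_def)
  have "card {t\<in>S. \<not> Q t} = card S - card {t\<in>S. Q t}"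
    using S by (subst card_Diff_subset[symmetric]) (auto intro!: arg_cong[where f = card])
  then have c2: "real (card {t\<in>S. \<not> Q t}) = c - c1"
    using S by (simp add: c_def c1_def of_nat_diff card_mono)
  have "(\<Sum>t\<in>S. pmf (bernoulli_pmf a) (Q t) / pmf (bernoulli_pmf b) (Q t)) =
      (\<Sum>t\<in>S. if Q t then a / b else (1 - a) / (1 - b))"
    using a b01 by (intro sum.cong) (auto simp: pmf_bernoulli_eq)
  also have "\<dots> = c1 * (a / b) + (c - c1) * ((1 - a) / (1 - b))"
    proof -
    have "(\<Sum>t\<in>S. if Q t then a / b else (1 - a) / (1 - b)) =
        c1 * (a / b) + real (card {t\<in>S. \<not> Q t}) * ((1 - a) / (1 - b))"
      using S by (simp add: sum.If_cases c1_def Int_def)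
    then show ?thesis by (simp only: c2)
  qed
  \<comment> \<open>Equality holds unless \<open>c1 = 0\<close>; then \<open>b = 0\<close> and the
    left side is 0. The other outcome behaves in the same way when \<open>c1 = c\<close>.\<close>
  also have "c1 * (a / b) \<le> c * a"
    using c c1 a by (cases "c1 = 0") (auto simp: b c_def[symmetric] c1_def[symmetric])
  also have "(c - c1) * ((1 - a) / (1 - b)) \<le> c * (1 - a)"
  proof (cases "c1 = c")
    case False
    then have "1 - b = (c - c1) / c" using c by (simp add: b c_def[symmetric] c1_def[symmetric] field_simps)
    then show ?thesis using False c1 c a by simp
  qed (use c a in auto)
  finally show ?thesis by (simp add: c_def algebra_simps)
qed simp

text \<open>For a fixed assignment the class frequencies maximise the likelihood. By
  \<open>ln x \<le> x - 1\<close>, applied to the ratio of the two probabilities, this reduces to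
  the quotient sums of the single classes.\<close>

lemma profile_loglik_ge:
  assumes p: "\<And>t j. t \<in> {1..T} \<Longrightarrow> j \<in> {1..n} \<Longrightarrow> 0 \<le> A (z t) j \<and> A (z t) j \<le> 1"
    and pos: "\<And>t j. t \<in> {1..T} \<Longrightarrow> j \<in> {1..n} \<Longrightarrow> 0 < pmf (bernoulli_pmf (A (z t) j)) (G t j)"
  shows "(\<Sum>t=1..T. \<Sum>j=1..n. ln (pmf (bernoulli_pmf (A (z t) j)) (G t j))) \<le> profile_loglik n T G z"
proof -
  define p where "p = (\<lambda>t j. pmf (bernoulli_pmf (A (z t) j)) (G t j))"
  define q where "q = (\<lambda>t j. pmf (bernoulli_pmf (A_hat T G z (z t) j)) (G t j))"
  have q: "0 < q t j" if "t \<in> {1..T}" for t j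
    using pmf_A_hat_pos[OF that] by (simp add: q_def)
  have "(\<Sum>t=1..T. ln (p t j)) \<le> (\<Sum>t=1..T. ln (q t j))" if j: "j \<in> {1..n}" for j
  proof -
    have "(\<Sum>t=1..T. ln (p t j) - ln (q t j)) \<le> (\<Sum>t=1..T. p t j / q t j - 1)"
    proof (intro sum_mono)
      fix t assume t: "t \<in> {1..T}"
      have "0 < p t j" using pos t j by (simp add: p_def)
      then show "ln (p t j) - ln (q t j) \<le> p t j / q t j - 1"
        using q[OF t] by (metis divide_pos_pos ln_div ln_le_minus_one less_irrefl)
    qed
    also have "\<dots> = (\<Sum>t=1..T. p t j / q t j) - real T" by (simp add: sum_subtractf)
    also have "(\<Sum>t=1..T. p t j / q t j) = (\<Sum>k\<in>z ` {1..T}. \<Sum>t\<in>{t\<in>{1..T}. z t = k}. p t j / q t j)"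
      by (rule sum.image_gen) simp
    also have "\<dots> \<le> (\<Sum>k\<in>z ` {1..T}. real (card {t\<in>{1..T}. z t = k}))"
    proof (intro sum_mono)
      fix k assume "k \<in> z ` {1..T}"
      then obtain s where s: "s \<in> {1..T}" "z s = k" by auto
      have "(\<Sum>t\<in>{t\<in>{1..T}. z t = k}. p t j / q t j) = (\<Sum>t\<in>{t\<in>{1..T}. z t = k}.
          pmf (bernoulli_pmf (A k j)) (G t j) / pmf (bernoulli_pmf (A_hat T G z k j)) (G t j))"
        by (intro sum.cong) (auto simp: p_def q_def)
      also have "\<dots> \<le> real (card {t\<in>{1..T}. z t = k})"
        using p[OF s(1) j] s by (intro sum_lik_quotient_le) (auto simp: A_hat_eq_card conj_assoc)
      finally show "(\<Sum>t\<in>{t\<in>{1..T}. z t = k}. p t j / q t j) \<le> real (card {t\<in>{1..T}. z t = k})" .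
    qed
    also have "\<dots> = (\<Sum>k\<in>z ` {1..T}. \<Sum>t\<in>{t\<in>{1..T}. z t = k}. 1)" by simp
    also have "\<dots> = (\<Sum>t=1..T. 1)" by (rule sum.image_gen[symmetric]) simp
    finally show ?thesis by (simp add: sum_subtractf)
  qed
  then have "(\<Sum>j=1..n. \<Sum>t=1..T. ln (p t j)) \<le> (\<Sum>j=1..n. \<Sum>t=1..T. ln (q t j))"
    by (rule sum_mono)
  then show ?thesis
    unfolding profile_loglik_eq using sum.swap[of "\<lambda>t j. ln (p t j)" "{1..n}" "{1..T}"]
      sum.swap[of "\<lambda>t j. ln (q t j)" "{1..n}" "{1..T}"]
    by (simp add: p_def q_def)
qed

text \<open>The likelihood of the truth is at most the profile likelihood at \<open>zs\<close>,
  hence at most that at \<open>z\<close>. The square roots of the likelihood ratios therefore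
  multiply to at least 1, and the compensating factors of \<open>lik_ratio\<close> remain as the
  lower bound.\<close>

lemma prod_lik_ratio_ge:
  assumes p: "\<And>t j. t \<in> {1..T} \<Longrightarrow> j \<in> {1..n} \<Longrightarrow> 0 \<le> A (zs t) j \<and> A (zs t) j \<le> 1"
    and pos: "\<And>t j. t \<in> {1..T} \<Longrightarrow> j \<in> {1..n} \<Longrightarrow> 0 < pmf (bernoulli_pmf (A (zs t) j)) (G t j)"
    and le: "profile_loglik n T G zs \<le> profile_loglik n T G z"
  shows "exp ((\<Sum>t=1..T. \<Sum>j=1..n. (A (zs t) j - A_hat T G z (z t) j)\<^sup>2) / 2)
    \<le> (\<Prod>t=1..T. \<Prod>j=1..n. lik_ratio (A (zs t) j) (A_hat T G z (z t) j) (G t j))"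
proof -
  define p where "p = (\<lambda>t j. pmf (bernoulli_pmf (A (zs t) j)) (G t j))"
  define q where "q = (\<lambda>t j. pmf (bernoulli_pmf (A_hat T G z (z t) j)) (G t j))"
  define h where "h = (\<lambda>t j. (A (zs t) j - A_hat T G z (z t) j)\<^sup>2)"
  have "(\<Sum>t=1..T. \<Sum>j=1..n. ln (p t j)) \<le> (\<Sum>t=1..T. \<Sum>j=1..n. ln (q t j))"
    using profile_loglik_ge[of T n A zs G, OF p pos] le by (simp add: profile_loglik_eq p_def q_def)
  then have "(\<Sum>t=1..T. \<Sum>j=1..n. h t j) / 2 \<le>
      (\<Sum>t=1..T. \<Sum>j=1..n. (ln (q t j) - ln (p t j)) / 2 + h t j / 2)"
    by (simp add: sum.distrib sum_subtractf sum_divide_distrib[symmetric])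
  then have "exp ((\<Sum>t=1..T. \<Sum>j=1..n. h t j) / 2) \<le>
      exp (\<Sum>t=1..T. \<Sum>j=1..n. (ln (q t j) - ln (p t j)) / 2 + h t j / 2)"
    by simp
  also have "\<dots> = (\<Prod>t=1..T. \<Prod>j=1..n. exp ((ln (q t j) - ln (p t j)) / 2) * exp (h t j / 2))"
    by (simp add: exp_sum exp_add)
  also have "\<dots> = (\<Prod>t=1..T. \<Prod>j=1..n. lik_ratio (A (zs t) j) (A_hat T G z (z t) j) (G t j))"
  proof (intro prod.cong refl)
    fix t j assume t: "t \<in> {1..T}" and j: "j \<in> {1..n}"
    have *: "0 < p t j" "0 < q t j" using pos[OF t j] pmf_A_hat_pos[OF t] by (simp_all add: p_def q_def)
    then have "exp ((ln (q t j) - ln (p t j)) / 2) = sqrt (q t j / p t j)"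
      by (intro real_sqrt_unique[symmetric])
        (simp_all add: power2_eq_square exp_add[symmetric] field_sum_of_halves exp_diff)
    then show "exp ((ln (q t j) - ln (p t j)) / 2) * exp (h t j / 2) =
        lik_ratio (A (zs t) j) (A_hat T G z (z t) j) (G t j)"
      by (simp add: lik_ratio_def h_def p_def q_def)
  qed
  finally show ?thesis by (simp add: h_def)
qed

text \<open>Every estimate is a quotient of two counts of at most \<open>T\<close>, an empty class
  giving \<open>0 / 0 = 0\<close>. Intersecting with the unit interval keeps each grid point a valid
  Bernoulli parameter.\<close>

definition hat_grid :: "nat \<Rightarrow> real set" where
  "hat_grid T = (\<lambda>(a, b). real a / real b) ` ({0..T} \<times> {0..T}) \<inter> {0..1}"

lemma finite_hat_grid: "finite (hat_grid T)"
  by (simp add: hat_grid_def)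

lemma card_hat_grid_le: "card (hat_grid T) \<le> (T + 1)\<^sup>2"
proof -
  have "card (hat_grid T) \<le> card ((\<lambda>(a, b). real a / real b) ` ({0..T} \<times> {0..T}))"
    unfolding hat_grid_def by (intro card_mono) auto
  also have "\<dots> \<le> card ({0..T} \<times> {0..T})"
    by (rule card_image_le) auto
  also have "\<dots> = (T + 1)\<^sup>2" by (simp add: power2_eq_square)
  finally show ?thesis .
qed

lemma A_hat_in_grid: "A_hat T G z i j \<in> hat_grid T"
proof -
  have "card {t\<in>{1..T}. z t = i} \<le> T" "card {t\<in>{1..T}. z t = i \<and> G t j} \<le> T"
    by (rule order.trans[OF card_mono[of "{1..T}"]]; auto)+
  then show ?thesis
    using A_hat_bounds[of T G z i j] unfolding hat_grid_def
    by (auto simp: A_hat_eq_card image_iff Bex_def)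
qed

text \<open>\<open>N\<close> bounds the number of pairs of an assignment and a grid matrix:
  \<open>card L\<close> labels for each of \<open>T\<close> groups, and at most
  \<open>(T + 1)^2\<close> values for each of \<open>card L * n\<close> entries. With the threshold
  \<open>N^2\<close>, each pair has probability at most \<open>1 / N^2\<close>, and the union bound
  leaves \<open>1 / N\<close>.\<close>

lemma prob_exists_lik_ratio_ge:
  assumes L: "finite L" "set_pmf \<rho> \<subseteq> L"
    and A: "\<And>i j. i \<in> L \<Longrightarrow> j \<in> {1..n} \<Longrightarrow> 0 \<le> A i j \<and> A i j \<le> 1"
    and N: "N = real (card L) ^ T * real (T + 1) ^ (2 * card L * n)" "0 < N"
  shows "measure_pmf.prob (hub_model_pmf n T \<rho> A)
      {\<omega>. \<exists>z. (\<forall>t\<in>{1..T}. z t \<in> L) \<and> N\<^sup>2 \<le> (\<Prod>t=1..T. \<Prod>j=1..n.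
         lik_ratio (A (fst (\<omega> t)) j) (A_hat T (observed \<omega>) z (z t) j) (observed \<omega> t j))} \<le> 1 / N"
    (is "measure_pmf.prob ?p ?E \<le> _")
proof -
  define Z where "Z = (\<Pi>\<^sub>E t\<in>{1..T}. L)"
  define BB where "BB = (\<Pi>\<^sub>E x\<in>L \<times> {1..n}. hat_grid T)"
  define E where "E = (\<lambda>(z :: nat \<Rightarrow> nat, B). {\<omega>. N\<^sup>2 \<le> (\<Prod>t=1..T. \<Prod>j=1..n.
      lik_ratio (A (fst (\<omega> t)) j) (B (z t, j)) (snd (\<omega> t) j))})"
  have fin: "finite (Z \<times> BB)"
    using L finite_hat_grid by (auto simp: Z_def BB_def intro!: finite_PiE)
  have "?E \<subseteq> (\<Union>x\<in>Z \<times> BB. E x)"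
  proof
    fix \<omega> assume "\<omega> \<in> ?E"
    then obtain z where z: "\<And>t. t \<in> {1..T} \<Longrightarrow> z t \<in> L" and ge: "N\<^sup>2 \<le> (\<Prod>t=1..T. \<Prod>j=1..n.
         lik_ratio (A (fst (\<omega> t)) j) (A_hat T (observed \<omega>) z (z t) j) (observed \<omega> t j))"
      unfolding mem_Collect_eq by blast
    \<comment> \<open>Restricting \<open>z\<close> and the estimated matrix to the relevant indices
      puts them into the finite sets \<open>Z\<close> and \<open>BB\<close> without changing the
      product.\<close>
    define z' where "z' = restrict z {1..T}"
    define B where "B = (\<lambda>x\<in>L \<times> {1..n}. A_hat T (observed \<omega>) z (fst x) (snd x))"
    have "(\<Prod>t=1..T. \<Prod>j=1..n.
         lik_ratio (A (fst (\<omega> t)) j) (A_hat T (observed \<omega>) z (z t) j) (observed \<omega> t j)) =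
       (\<Prod>t=1..T. \<Prod>j=1..n. lik_ratio (A (fst (\<omega> t)) j) (B (z' t, j)) (snd (\<omega> t) j))"
      using z by (intro prod.cong refl) (auto simp: B_def z'_def observed_def)
    then have "\<omega> \<in> E (z', B)" using ge by (simp add: E_def)
    moreover have "z' \<in> Z" using z by (auto simp: z'_def Z_def)
    moreover have "B \<in> BB" by (auto simp: B_def BB_def A_hat_in_grid)
    ultimately show "\<omega> \<in> (\<Union>x\<in>Z \<times> BB. E x)" by blast
  qed
  then have "measure_pmf.prob ?p ?E \<le> measure_pmf.prob ?p (\<Union>x\<in>Z \<times> BB. E x)"
    by (intro measure_pmf.finite_measure_mono) auto
  also have "\<dots> \<le> (\<Sum>x\<in>Z \<times> BB. measure_pmf.prob ?p (E x))"
    using fin by (intro measure_pmf.finite_measure_subadditive_finite) auto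
  also have "\<dots> \<le> (\<Sum>x\<in>Z \<times> BB. 1 / N\<^sup>2)"
  proof (intro sum_mono)
    fix x assume x: "x \<in> Z \<times> BB"
    obtain z B where x': "x = (z, B)" by (cases x)
    have "B (z t, j) \<in> {0..1}" if "t \<in> {1..T}" "j \<in> {1..n}" for t j
    proof -
      have "z t \<in> L" using x x' that by (auto simp: Z_def)
      then have "B (z t, j) \<in> hat_grid T" using x x' that by (auto simp: BB_def)
      then show ?thesis by (simp add: hat_grid_def)
    qed
    then show "measure_pmf.prob ?p (E x) \<le> 1 / N\<^sup>2"
      unfolding x' E_def prod.case using \<open>0 < N\<close> by (intro prob_lik_ratio_ge[OF L A]) auto
  qed
  also have "\<dots> = real (card Z * card BB) / N\<^sup>2"
    by (simp add: card_cartesian_product)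
  also have "\<dots> \<le> N / N\<^sup>2"
  proof (intro divide_right_mono)
    have "card BB \<le> ((T + 1)\<^sup>2) ^ (card L * n)"
      using L card_hat_grid_le by (auto simp: BB_def card_PiE card_cartesian_product intro!: power_mono)
    then have "card Z * card BB \<le> card L ^ T * (T + 1) ^ (2 * card L * n)"
      by (intro mult_mono) (auto simp: Z_def card_PiE power_mult mult.assoc)
    then have "real (card Z * card BB) \<le> real (card L ^ T * (T + 1) ^ (2 * card L * n))"
      by (rule of_nat_mono)
    then show "real (card Z * card BB) \<le> N" by (simp add: N add.commute)
  qed simp
  also have "\<dots> = 1 / N" using N by (simp add: power2_eq_square)
  finally show ?thesis .
qed

subsection \<open>The error bound for one model\<close>

text \<open>A deterministic statement about one outcome: fit in mean square gives dominance of the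
  correct labels, which gives accurate frequencies. The bound on \<open>e\<close> arises by dividing
  the fit \<open>4 * ln N\<close> by the cost \<open>d^2 / 4 * (v * n / nL)\<close> of one minority
  group.\<close>

lemma estimator_error_le:
  fixes nL n T :: nat and A :: "nat \<Rightarrow> nat \<Rightarrow> real"
  assumes params: "hub_params nL n \<rho> A"
    and zs: "\<And>t. t \<in> {1..T} \<Longrightarrow> zs t \<in> {1..nL}"
    and pos: "\<And>t j. t \<in> {1..T} \<Longrightarrow> j \<in> {1..n} \<Longrightarrow> 0 < pmf (bernoulli_pmf (A (zs t) j)) (G t j)"
    and feas: "feasible nL T G z"
    and le: "profile_loglik n T G zs \<le> profile_loglik n T G z"
    and N: "1 \<le> N" "(\<Prod>t=1..T. \<Prod>j=1..n. lik_ratio (A (zs t) j) (A_hat T G z (z t) j) (G t j)) < N\<^sup>2"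
    and d: "0 < d" and v: "0 < v"
    and separation: "\<And>i. i \<in> {1..nL} \<Longrightarrow> \<exists>V\<subseteq>{1..n}. real (card V) \<ge> v * real n / real nL \<and>
            (\<forall>j\<in>V. \<forall>i'\<in>{1..nL}. i' \<noteq> i \<longrightarrow> A i j - A i' j \<ge> d)"
    and e: "16 * real nL * ln N / (d\<^sup>2 * v * real n) \<le> e"
    and b: "\<And>i k. i \<in> {1..nL} \<Longrightarrow> k \<in> {1..nL} \<Longrightarrow> i \<noteq> k \<Longrightarrow>
        real (card {t\<in>{1..T}. zs t = i \<and> G t k}) \<le> b"
    and s: "\<And>i. i \<in> {1..nL} \<Longrightarrow> s \<le> real (card {t\<in>{1..T}. zs t = i})"
    and sep: "2 * e < s" "e + b < s" "real nL * b\<^sup>2 < (s - e - b)\<^sup>2"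
    and mean: "\<bar>\<Sum>t=1..T. of_bool (zs t = i) * (of_bool (G t j) - A i j)\<bar> \<le> x"
    and i: "i \<in> {1..nL}" and j: "j \<in> {1..n}"
  shows "\<bar>A_hat T G z i j - A i j\<bar> \<le> (x + 2 * e) / (s - e)"
proof -
  define f where "f = (\<lambda>i k. real (card {t\<in>{1..T}. z t = k \<and> zs t = i}))"
  define r where "r = (\<lambda>i k. real (card {t\<in>{1..T}. z t = k \<and> zs t \<noteq> i}))"
  have A01: "0 \<le> A i j \<and> A i j \<le> 1" if "i \<in> {1..nL}" "j \<in> {1..n}" for i j
    using params that by (auto simp: hub_params_def)
  have z: "z t \<in> {1..nL}" "G t (z t)" if "t \<in> {1..T}" for t
    using feas that by (auto simp: feasible_def)
  have nL: "0 < real nL" and n: "0 < real n" using i j by auto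
  have "exp ((\<Sum>t=1..T. \<Sum>j=1..n. (A (zs t) j - A_hat T G z (z t) j)\<^sup>2) / 2) < N\<^sup>2"
    using prod_lik_ratio_ge[OF _ pos le] A01 zs N by (meson le_less_trans)
  also have "N\<^sup>2 = exp (2 * ln N)"
    using N by (simp add: exp_double)
  finally have R: "(\<Sum>t=1..T. \<Sum>j=1..n. (A (zs t) j - A_hat T G z (z t) j)\<^sup>2) < 4 * ln N"
    by simp
  have min_le: "(\<Sum>k\<in>{1..nL}. min (f i k) (r i k)) \<le> e" if i: "i \<in> {1..nL}" for i
  proof -
    obtain V where V: "V \<subseteq> {1..n}" "real (card V) \<ge> v * real n / real nL"
      "\<And>j i'. j \<in> V \<Longrightarrow> i' \<in> {1..nL} \<Longrightarrow> i' \<noteq> i \<Longrightarrow> A i j - A i' j \<ge> d"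
      using separation[OF i] by blast
    have "d\<^sup>2 / 4 * (v * real n / real nL) * (\<Sum>k\<in>{1..nL}. min (f i k) (r i k)) \<le>
        d\<^sup>2 / 4 * real (card V) * (\<Sum>k\<in>{1..nL}. min (f i k) (r i k))"
      using V(2) by (intro mult_right_mono mult_left_mono sum_nonneg) (auto simp: f_def r_def)
    also have "\<dots> \<le> (\<Sum>t=1..T. \<Sum>j=1..n. (A (zs t) j - A_hat T G z (z t) j)\<^sup>2)"
      unfolding f_def r_def by (rule sum_min_count_le) (use z zs V d in auto)
    finally have "d\<^sup>2 / 4 * (v * real n / real nL) * (\<Sum>k\<in>{1..nL}. min (f i k) (r i k)) \<le> 4 * ln N"
      using R by simp
    then have "(\<Sum>k\<in>{1..nL}. min (f i k) (r i k)) \<le> 16 * real nL * ln N / (d\<^sup>2 * v * real n)"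
      using d v n nL by (simp add: field_simps)
    then show ?thesis using e by simp
  qed
  have sum_f: "(\<Sum>k\<in>K. f i k) = real (card {t\<in>{1..T}. z t \<in> K \<and> zs t = i})" if "finite K" for i K
  proof -
    have "(\<Sum>k\<in>K. f i k) = real (card (\<Union>k\<in>K. {t\<in>{1..T}. z t = k \<and> zs t = i}))"
      unfolding f_def using that by (subst card_UN_disjoint) auto
    also have "(\<Union>k\<in>K. {t\<in>{1..T}. z t = k \<and> zs t = i}) = {t\<in>{1..T}. z t \<in> K \<and> zs t = i}"
      by auto
    finally show ?thesis .
  qed
  \<comment> \<open>Feasibility enters here: a group assigned to \<open>k\<close> contains node
    \<open>k\<close>, so it is counted among the groups of hub \<open>i\<close> in which
    \<open>k\<close> appears.\<close>
  have f_b: "f i k \<le> b" if "i \<in> {1..nL}" "k \<in> {1..nL}" "i \<noteq> k" for i k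
  proof -
    have "card {t\<in>{1..T}. z t = k \<and> zs t = i} \<le> card {t\<in>{1..T}. zs t = i \<and> G t k}"
      using z by (intro card_mono) auto
    then show ?thesis using b[OF that] by (simp add: f_def)
  qed
  have f_s: "s \<le> (\<Sum>k\<in>{1..nL}. f i k)" if "i \<in> {1..nL}" for i
  proof -
    have "{t\<in>{1..T}. z t \<in> {1..nL} \<and> zs t = i} = {t\<in>{1..T}. zs t = i}" using z by auto
    then show ?thesis using s[OF that] by (simp add: sum_f)
  qed
  have f_r: "f i k \<le> r i' k" if "i \<noteq> i'" for i i' k
    using that unfolding f_def r_def by (intro of_nat_mono card_mono) auto
  note dom = label_dominance[of "{1..nL}" f r e b s, OF _ _ _ f_r min_le f_b f_s sep(1,2) _ i]
  have "(\<Sum>k\<in>{1..nL} - {i}. f i k) \<le> e" "r i i \<le> e"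
    by (rule dom; use sep in \<open>simp add: f_def r_def\<close>)+
  moreover have "{t\<in>{1..T}. z t \<in> {1..nL} - {i} \<and> zs t = i} = {t\<in>{1..T}. z t \<noteq> i \<and> zs t = i}"
    using z by auto
  ultimately have e12: "real (card {t\<in>{1..T}. z t \<noteq> i \<and> zs t = i}) \<le> e"
      "real (card {t\<in>{1..T}. z t = i \<and> zs t \<noteq> i}) \<le> e"
    by (simp_all only: sum_f finite_Diff finite_atLeastAtMost r_def)
  have "0 \<le> e" using e12(1) by (rule order.trans[OF of_nat_0_le_iff])
  then show ?thesis
    using sep by (intro A_hat_error_le[where zs = zs] mean e12 s i) (use A01 i j in auto)
qed

section \<open>Tail bounds under the true assignment\<close>

lemma prob_UN_le:
  assumes "finite I" "\<And>i. i \<in> I \<Longrightarrow> measure_pmf.prob p (E i) \<le> c"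
  shows "measure_pmf.prob p (\<Union>i\<in>I. E i) \<le> real (card I) * c"
proof -
  have "measure_pmf.prob p (\<Union>i\<in>I. E i) \<le> (\<Sum>i\<in>I. measure_pmf.prob p (E i))"
    using assms by (intro measure_pmf.finite_measure_subadditive_finite) auto
  also have "\<dots> \<le> (\<Sum>i\<in>I. c)" using assms by (intro sum_mono)
  finally show ?thesis by simp
qed

lemma set_hub_model_pmf:
  assumes "\<omega> \<in> set_pmf (hub_model_pmf n T \<rho> A)" "t \<in> {1..T}"
  shows "fst (\<omega> t) \<in> set_pmf \<rho>"
    and "j \<in> {1..n} \<Longrightarrow> observed \<omega> t j \<in> set_pmf (bernoulli_pmf (A (fst (\<omega> t)) j))"
proof -
  have "\<omega> t \<in> set_pmf (hub_group_pmf n \<rho> A)"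
    using assms by (auto simp: hub_model_pmf_def set_Pi_pmf PiE_dflt_def)
  then obtain i g where *: "\<omega> t = (i, g)" "i \<in> set_pmf \<rho>" "g \<in> set_pmf (group_pmf n (A i))"
    by (auto simp: hub_group_pmf_def)
  then show "fst (\<omega> t) \<in> set_pmf \<rho>" by simp
  show "observed \<omega> t j \<in> set_pmf (bernoulli_pmf (A (fst (\<omega> t)) j))" if "j \<in> {1..n}"
    using * that by (auto simp: group_pmf_def set_Pi_pmf PiE_dflt_def observed_def)
qed

lemma prob_hub_frequency_le:
  assumes L: "finite L" "set_pmf \<rho> \<subseteq> L" and i: "i \<in> L" and c: "c \<le> pmf \<rho> i"
  shows "measure_pmf.prob (hub_model_pmf n T \<rho> A)
      {\<omega>. real (card {t\<in>{1..T}. fst (\<omega> t) = i}) \<le> c * real T / 2} \<le> exp (- (c * real T / 10))"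
proof -
  \<comment> \<open>Each group of hub \<open>i\<close> gets weight -1 and moment at most
    \<open>2 / 5 = 1 - 3 / 5\<close>. The rate \<open>1 / 10\<close> in the exponent is
    \<open>3 / 5 - 1 / 2\<close>.\<close>
  have "(5/2 :: real) \<le> exp 1" using exp_lower_Taylor_quadratic[of 1] by simp
  then have "exp (- 1) \<le> 1 + (- 3 / 5 :: real)" by (simp add: exp_minus field_simps)
  then have "measure_pmf.prob (hub_model_pmf n T \<rho> A)
      {\<omega>. - (c * real T / 2) \<le> (\<Sum>t=1..T. of_bool (fst (\<omega> t) = i) * (- 1))}
    \<le> exp (real T * pmf \<rho> i * (- 3 / 5) - (- (c * real T / 2)))"
    by (intro prob_hub_count_ge[OF L i]) simp
  also have "\<dots> \<le> exp (- (c * real T / 10))"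
    using mult_left_mono[OF c, of "real T"] by (simp add: algebra_simps)
  finally show ?thesis by (simp add: sum_negf Int_def)
qed

lemma prob_hub_cooccurrence_ge:
  assumes L: "finite L" "set_pmf \<rho> \<subseteq> L" and i: "i \<in> L" and k: "k \<in> {1..n}"
    and a: "0 \<le> A i k" "A i k \<le> 1" and c: "pmf \<rho> i * A i k \<le> c"
  shows "measure_pmf.prob (hub_model_pmf n T \<rho> A)
      {\<omega>. 3 * c * real T \<le> real (card {t\<in>{1..T}. fst (\<omega> t) = i \<and> observed \<omega> t k})}
    \<le> exp (- (c * real T))"
proof -
  \<comment> \<open>The moment excess is at most \<open>2 * A i k\<close>, so the threshold
    \<open>3 * c * T\<close> leaves \<open>c * T\<close> in the exponent.\<close>
  have "exp 1 * A i k \<le> 3 * A i k" using exp_le a by (intro mult_right_mono) auto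
  then have "measure_pmf.expectation (group_pmf n (A i)) (\<lambda>g. exp (of_bool (g k))) \<le> 1 + 2 * A i k"
    using expectation_group_pmf_component[of k n "A i" "\<lambda>x. exp (of_bool x)"] k a by (simp add: algebra_simps)
  then have "measure_pmf.prob (hub_model_pmf n T \<rho> A)
      {\<omega>. 3 * c * real T \<le> (\<Sum>t=1..T. of_bool (fst (\<omega> t) = i) * of_bool (snd (\<omega> t) k))}
    \<le> exp (real T * pmf \<rho> i * (2 * A i k) - 3 * c * real T)"
    by (rule prob_hub_count_ge[OF L i])
  also have "\<dots> \<le> exp (- (c * real T))"
    using mult_left_mono[OF c, of "real T"] by (simp add: algebra_simps)
  finally show ?thesis
    by (simp add: observed_def Int_def of_bool_conj[symmetric] del: sum_of_bool_mult_eq)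
qed

text \<open>A two-sided Chernoff bound with parameters plus and minus \<open>\<theta>\<close>. The
  linear term vanishes by centring, so the moment excess is at most \<open>\<theta>^2\<close>; the
  condition \<open>2 * c * \<theta> \<le> \<delta>\<close> makes this consume at most half of the
  exponent.\<close>

lemma prob_hub_mean_ge:
  assumes L: "finite L" "set_pmf \<rho> \<subseteq> L" and i: "i \<in> L" and j: "j \<in> {1..n}"
    and a: "0 \<le> A i j" "A i j \<le> 1" and c: "pmf \<rho> i \<le> c"
    and \<theta>: "0 < \<theta>" "\<theta> \<le> 1" "2 * c * \<theta> \<le> \<delta>"
  shows "measure_pmf.prob (hub_model_pmf n T \<rho> A)
      {\<omega>. \<delta> * real T \<le> \<bar>\<Sum>t=1..T. of_bool (fst (\<omega> t) = i) * (of_bool (observed \<omega> t j) - A i j)\<bar>}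
    \<le> 2 * exp (- (\<theta> * \<delta> / 2 * real T))"
proof -
  define S where "S = (\<lambda>\<omega>. \<Sum>t=1..T. of_bool (fst (\<omega> t) = i) * (of_bool (observed \<omega> t j) - A i j))"
  have *: "measure_pmf.prob (hub_model_pmf n T \<rho> A) {\<omega>. \<theta> * (\<delta> * real T) \<le> l * S \<omega>}
    \<le> exp (- (\<theta> * \<delta> / 2 * real T))" if l: "\<bar>l\<bar> = \<theta>" for l
  proof -
    have eq: "(\<Sum>t=1..T. of_bool (fst (\<omega> t) = i) * (l * (of_bool (snd (\<omega> t) j) - A i j))) = l * S \<omega>" for \<omega>
      by (simp only: S_def observed_def sum_distrib_left mult.left_commute[of l])
    have l2: "l\<^sup>2 = \<theta>\<^sup>2" using l by (metis power2_abs)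
    have b: "exp (l * (x - A i j)) \<le> 1 + l * (x - A i j) + (l * (x - A i j))\<^sup>2" if "x \<in> {0, 1}" for x
    proof -
      have "\<bar>l * (x - A i j)\<bar> \<le> 1 * 1"
        unfolding abs_mult using l \<theta> a that by (intro mult_mono) auto
      then show ?thesis by (intro exp_quadratic_bound) simp
    qed
    have "measure_pmf.expectation (group_pmf n (A i)) (\<lambda>g. exp (l * (of_bool (g j) - A i j)))
        = A i j * exp (l * (1 - A i j)) + (1 - A i j) * exp (l * (0 - A i j))"
      using expectation_group_pmf_component[where a = "A i", OF j a, of "\<lambda>x. exp (l * (of_bool x - A i j))"] by simp
    also have "\<dots> \<le> A i j * (1 + l * (1 - A i j) + (l * (1 - A i j))\<^sup>2) +
        (1 - A i j) * (1 + l * (0 - A i j) + (l * (0 - A i j))\<^sup>2)"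
      using a by (intro add_mono mult_left_mono b) auto
    also have "\<dots> = 1 + \<theta>\<^sup>2 * (A i j * (1 - A i j))"
      unfolding l2[symmetric] by (simp add: power2_eq_square algebra_simps)
    also have "\<dots> \<le> 1 + \<theta>\<^sup>2 * (1 * 1)"
      using a by (intro add_left_mono mult_left_mono mult_mono) auto
    finally have "measure_pmf.prob (hub_model_pmf n T \<rho> A) {\<omega>. \<theta> * (\<delta> * real T) \<le>
        (\<Sum>t=1..T. of_bool (fst (\<omega> t) = i) * (l * (of_bool (snd (\<omega> t) j) - A i j)))}
      \<le> exp (real T * pmf \<rho> i * \<theta>\<^sup>2 - \<theta> * (\<delta> * real T))"
      by (intro prob_hub_count_ge[OF L i]) simp
    also have "\<dots> \<le> exp (- (\<theta> * \<delta> / 2 * real T))"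
    proof -
      have "pmf \<rho> i * \<theta>\<^sup>2 \<le> c * \<theta>\<^sup>2" using c by (intro mult_right_mono) auto
      also have "\<dots> \<le> \<theta> * \<delta> / 2" using \<theta> by (simp add: power2_eq_square field_simps)
      finally have "real T * (pmf \<rho> i * \<theta>\<^sup>2) \<le> real T * (\<theta> * \<delta> / 2)" by (intro mult_left_mono) auto
      then show ?thesis by (simp add: algebra_simps)
    qed
    finally show ?thesis by (simp only: eq)
  qed
  have "{\<omega>. \<delta> * real T \<le> \<bar>S \<omega>\<bar>} \<subseteq> {\<omega>. \<theta> * (\<delta> * real T) \<le> \<theta> * S \<omega>} \<union> {\<omega>. \<theta> * (\<delta> * real T) \<le> - \<theta> * S \<omega>}"
  proof
    fix \<omega> assume "\<omega> \<in> {\<omega>. \<delta> * real T \<le> \<bar>S \<omega>\<bar>}"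
    then have "\<delta> * real T \<le> S \<omega> \<or> \<delta> * real T \<le> - S \<omega>" by auto
    then have "\<theta> * (\<delta> * real T) \<le> \<theta> * S \<omega> \<or> \<theta> * (\<delta> * real T) \<le> \<theta> * - S \<omega>"
      using \<theta>(1) by (meson mult_left_mono less_imp_le)
    then show "\<omega> \<in> {\<omega>. \<theta> * (\<delta> * real T) \<le> \<theta> * S \<omega>} \<union> {\<omega>. \<theta> * (\<delta> * real T) \<le> - \<theta> * S \<omega>}" by simp
  qed
  then have "measure_pmf.prob (hub_model_pmf n T \<rho> A) {\<omega>. \<delta> * real T \<le> \<bar>S \<omega>\<bar>} \<le>
      measure_pmf.prob (hub_model_pmf n T \<rho> A) ({\<omega>. \<theta> * (\<delta> * real T) \<le> \<theta> * S \<omega>} \<union> {\<omega>. \<theta> * (\<delta> * real T) \<le> - \<theta> * S \<omega>})"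
    by (intro measure_pmf.finite_measure_mono) auto
  also have "\<dots> \<le> exp (- (\<theta> * \<delta> / 2 * real T)) + exp (- (\<theta> * \<delta> / 2 * real T))"
    using \<theta> by (intro order.trans[OF measure_Un_le] add_mono *) auto
  finally show ?thesis by (simp add: S_def)
qed

text \<open>The bad events are a large likelihood ratio (\<open>E1\<close>), a rare hub
  (\<open>E2\<close>), a frequent co-occurrence (\<open>E3\<close>) and a deviating frequency under
  the true assignment (\<open>E4\<close>). All counts are measured in units of
  \<open>T / nL\<close>, which turns the dominance conditions into inequalities between
  \<open>\<eta>\<close>, \<open>c_min\<close> and \<open>K / nL\<close>.\<close>

lemma prob_error_gt_le:
  fixes nL n T :: nat and A :: "nat \<Rightarrow> nat \<Rightarrow> real"
  assumes params: "hub_params nL n \<rho> A"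
    and estimator: "profile_estimator nL n T zhat"
    and \<rho>: "\<And>i. i \<in> {1..nL} \<Longrightarrow> c_min / real nL \<le> pmf \<rho> i \<and> pmf \<rho> i \<le> c_max / real nL"
    and sparse: "\<And>i k. i \<in> {1..nL} \<Longrightarrow> k \<in> {1..nL} \<Longrightarrow> i \<noteq> k \<Longrightarrow> A i k \<le> c0 / real nL"
    and d: "0 < d" and v: "0 < v" and T: "1 \<le> T" and c_max: "0 < c_max"
    and separation: "\<And>i. i \<in> {1..nL} \<Longrightarrow> \<exists>V\<subseteq>{1..n}. real (card V) \<ge> v * real n / real nL \<and>
            (\<forall>j\<in>V. \<forall>i'\<in>{1..nL}. i' \<noteq> i \<longrightarrow> A i j - A i' j \<ge> d)"
    and N: "N = real nL ^ T * real (T + 1) ^ (2 * nL * n)"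
    and \<eta>: "16 * real nL * ln N / (d\<^sup>2 * v * real n) \<le> \<eta> * (real T / real nL)"
    and K: "K = c_max * c0"
    and sep: "2 * \<eta> < c_min / 2" "\<eta> + 3 * K / real nL < c_min / 2"
      "9 * K\<^sup>2 / real nL < (c_min / 2 - \<eta> - 3 * K / real nL)\<^sup>2"
    and \<theta>: "0 < \<theta>" "\<theta> \<le> 1" "2 * c_max * \<theta> \<le> \<delta>"
    and \<epsilon>: "(\<delta> + 2 * \<eta>) / (c_min / 2 - \<eta>) \<le> \<epsilon>"
  shows "measure_pmf.prob (hub_model_pmf n T \<rho> A)
      {\<omega>. \<bar>MAX (i, j)\<in>{1..nL} \<times> {1..n}.
         \<bar>A_hat T (observed \<omega>) (zhat (observed \<omega>)) i j - A i j\<bar>\<bar> > \<epsilon>}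
    \<le> 1 / real (T + 1) + real nL * exp (- (c_min / 10 * (real T / real nL)))
      + (real nL)\<^sup>2 * exp (- (K * (real T / (real nL)\<^sup>2)))
      + real nL * real n * (2 * exp (- (\<theta> * \<delta> / 2 * (real T / real nL))))"
proof -
  let ?P = "measure_pmf.prob (hub_model_pmf n T \<rho> A)"
  define L where "L = {1..nL}"
  have L: "finite L" "set_pmf \<rho> \<subseteq> L" using params by (auto simp: L_def hub_params_def)
  have nLn: "nL \<le> n" using params by (simp add: hub_params_def)
  have A01: "0 \<le> A i j \<and> A i j \<le> 1" if "i \<in> L" "j \<in> {1..n}" for i j
    using params that by (auto simp: hub_params_def L_def)
  have "set_pmf \<rho> \<noteq> {}" by (rule set_pmf_not_empty)
  then have nL: "1 \<le> nL" using L by (auto simp: L_def)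
  have nL0: "0 < real nL" using nL by auto
  define u where "u = real T / real nL"
  have u: "0 < u" using nL T by (simp add: u_def)
  define b s where "b = 3 * (K / (real nL)\<^sup>2) * real T" and "s = c_min / real nL * real T / 2"
  have b_u: "b = 3 * K / real nL * u" and s_u: "s = c_min / 2 * u"
    by (simp_all add: b_def s_def u_def power2_eq_square)
  define E1 where "E1 = {\<omega>. \<exists>z. (\<forall>t\<in>{1..T}. z t \<in> L) \<and> N\<^sup>2 \<le> (\<Prod>t=1..T. \<Prod>j=1..n.
         lik_ratio (A (fst (\<omega> t)) j) (A_hat T (observed \<omega>) z (z t) j) (observed \<omega> t j))}"
  define E2 where "E2 = (\<lambda>i. {\<omega> :: nat \<Rightarrow> nat \<times> (nat \<Rightarrow> bool). real (card {t\<in>{1..T}. fst (\<omega> t) = i}) \<le> s})"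
  define E3 where "E3 = (\<lambda>(i, k). {\<omega>. b \<le> real (card {t\<in>{1..T}. fst (\<omega> t) = i \<and> observed \<omega> t k})})"
  define E4 where "E4 = (\<lambda>(i, j). {\<omega>. \<delta> / real nL * real T \<le>
      \<bar>\<Sum>t=1..T. of_bool (fst (\<omega> t) = i) * (of_bool (observed \<omega> t j) - A i j)\<bar>})"
  define I3 where "I3 = {(i, k) \<in> L \<times> L. i \<noteq> k}"
  \<comment> \<open>This replaces \<open>1 / N\<close> by \<open>1 / (T + 1)\<close>, which visibly
    vanishes in the limit.\<close>
  have "real (T + 1) ^ 1 \<le> real (T + 1) ^ (2 * nL * n)"
    using nL nLn by (intro power_increasing) auto
  moreover have "1 \<le> real nL ^ T" using nL by simp
  ultimately have "1 * real (T + 1) ^ 1 \<le> N" unfolding N by (intro mult_mono) auto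
  then have N1: "real (T + 1) \<le> N" by simp
  then have N0: "0 < N" "1 \<le> N" by auto
  let ?F = "{\<omega>. \<bar>MAX (i, j)\<in>{1..nL} \<times> {1..n}.
         \<bar>A_hat T (observed \<omega>) (zhat (observed \<omega>)) i j - A i j\<bar>\<bar> > \<epsilon>}"
  \<comment> \<open>On the support all observed outcomes have positive probability under the truth,
    and \<open>A i i = 1\<close> makes the true assignment feasible, so the estimator can be
    compared with it.\<close>
  have incl: "?F \<inter> set_pmf (hub_model_pmf n T \<rho> A) \<subseteq>
      E1 \<union> (\<Union>i\<in>L. E2 i) \<union> (\<Union>x\<in>I3. E3 x) \<union> (\<Union>x\<in>L \<times> {1..n}. E4 x)"
  proof (rule subsetI, rule ccontr)
    fix \<omega> assume \<omega>: "\<omega> \<in> ?F \<inter> set_pmf (hub_model_pmf n T \<rho> A)"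
    assume "\<omega> \<notin> E1 \<union> (\<Union>i\<in>L. E2 i) \<union> (\<Union>x\<in>I3. E3 x) \<union> (\<Union>x\<in>L \<times> {1..n}. E4 x)"
    then have not_E: "\<omega> \<notin> E1" "\<And>i. i \<in> L \<Longrightarrow> \<omega> \<notin> E2 i"
      "\<And>i k. i \<in> L \<Longrightarrow> k \<in> L \<Longrightarrow> i \<noteq> k \<Longrightarrow> \<omega> \<notin> E3 (i, k)"
      "\<And>i j. i \<in> L \<Longrightarrow> j \<in> {1..n} \<Longrightarrow> \<omega> \<notin> E4 (i, j)"
      by (auto simp: I3_def)
    define zs where "zs = (\<lambda>t. fst (\<omega> t))"
    define G where "G = observed \<omega>"
    have supp: "\<omega> \<in> set_pmf (hub_model_pmf n T \<rho> A)" using \<omega> by blast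
    have zs: "zs t \<in> L" if "t \<in> {1..T}" for t
      using set_hub_model_pmf(1)[OF supp that] L by (auto simp: zs_def)
    have pos: "0 < pmf (bernoulli_pmf (A (zs t) j)) (G t j)" if "t \<in> {1..T}" "j \<in> {1..n}" for t j
      using set_hub_model_pmf(2)[OF supp that] by (simp add: G_def zs_def pmf_positive)
    have "G t (zs t)" if t: "t \<in> {1..T}" for t
    proof -
      have "A (zs t) (zs t) = 1" "zs t \<in> {1..n}"
        using zs[OF t] params nLn by (auto simp: hub_params_def L_def)
      then show ?thesis using pos[OF t, of "zs t"] by (cases "G t (zs t)") auto
    qed
    then have feas_zs: "feasible nL T G zs"
      using zs by (auto simp: feasible_def L_def)
    then have "is_arg_max (profile_loglik n T G) (feasible nL T G) (zhat G)"
      using estimator unfolding profile_estimator_def by blast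
    then have feas: "feasible nL T G (zhat G)"
      and le: "profile_loglik n T G zs \<le> profile_loglik n T G (zhat G)"
      using feas_zs by (auto simp: is_arg_max_linorder)
    have zh: "\<forall>t\<in>{1..T}. zhat G t \<in> L" using feas by (auto simp: feasible_def L_def)
    have lik: "(\<Prod>t=1..T. \<Prod>j=1..n. lik_ratio (A (zs t) j) (A_hat T G (zhat G) (zhat G t) j) (G t j)) < N\<^sup>2"
      using not_E(1) zh unfolding E1_def mem_Collect_eq G_def zs_def by (meson not_le)
    have err: "\<bar>A_hat T G (zhat G) i j - A i j\<bar> \<le> \<epsilon>" if i: "i \<in> {1..nL}" and j: "j \<in> {1..n}" for i j
    proof -
      have "\<bar>A_hat T G (zhat G) i j - A i j\<bar> \<le> (\<delta> * u + 2 * (\<eta> * u)) / (s - \<eta> * u)"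
      proof (rule estimator_error_le[OF params _ pos feas le N0(2) lik d v separation _ _ _ _ _ _ _ i j])
        show "zs t \<in> {1..nL}" if "t \<in> {1..T}" for t using zs[OF that] by (simp add: L_def)
        show "16 * real nL * ln N / (d\<^sup>2 * v * real n) \<le> \<eta> * u" using \<eta> by (simp add: u_def)
        show "real (card {t\<in>{1..T}. zs t = i \<and> G t k}) \<le> b"
          if "i \<in> {1..nL}" "k \<in> {1..nL}" "i \<noteq> k" for i k
          using not_E(3)[of i k] that by (simp add: E3_def L_def zs_def G_def)
        show "s \<le> real (card {t\<in>{1..T}. zs t = i})" if "i \<in> {1..nL}" for i
          using not_E(2)[of i] that by (simp add: E2_def L_def zs_def)
        show "2 * (\<eta> * u) < s"
          using mult_strict_right_mono[OF sep(1) u] by (simp add: s_u)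
        show "\<eta> * u + b < s"
          using mult_strict_right_mono[OF sep(2) u] unfolding b_u s_u by (simp only: distrib_right)
        have "9 * K\<^sup>2 / real nL * u\<^sup>2 < (c_min / 2 - \<eta> - 3 * K / real nL)\<^sup>2 * u\<^sup>2"
          using sep(3) u by (intro mult_strict_right_mono) auto
        then show "real nL * b\<^sup>2 < (s - \<eta> * u - b)\<^sup>2"
          unfolding b_u s_u power_mult_distrib[symmetric] left_diff_distrib[symmetric]
          using nL0 by (simp add: power2_eq_square field_simps)
        show "\<bar>\<Sum>t=1..T. of_bool (zs t = i) * (of_bool (G t j) - A i j)\<bar> \<le> \<delta> * u"
          using not_E(4)[of i j] i j by (simp add: E4_def L_def zs_def G_def u_def)
      qed
      also have "\<dots> = ((\<delta> + 2 * \<eta>) * u) / ((c_min / 2 - \<eta>) * u)"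
        unfolding s_u by (simp add: algebra_simps)
      also have "\<dots> = (\<delta> + 2 * \<eta>) / (c_min / 2 - \<eta>)" using u by simp
      finally show ?thesis using \<epsilon> by simp
    qed
    let ?S = "(\<lambda>(i, j). \<bar>A_hat T G (zhat G) i j - A i j\<bar>) ` ({1..nL} \<times> {1..n})"
    have "Max ?S \<in> ?S" using nL nLn by (intro Max_in) auto
    then have "\<bar>Max ?S\<bar> \<le> \<epsilon>" using err by auto
    then show False using \<omega> by (simp add: G_def)
  qed
  have "?P ?F = ?P (?F \<inter> set_pmf (hub_model_pmf n T \<rho> A))"
    by (simp only: measure_Int_set_pmf)
  also have "\<dots> \<le> ?P (E1 \<union> (\<Union>i\<in>L. E2 i) \<union> (\<Union>x\<in>I3. E3 x) \<union> (\<Union>x\<in>L \<times> {1..n}. E4 x))"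
    using incl by (intro measure_pmf.finite_measure_mono) auto
  also have "\<dots> \<le> ?P E1 + ?P (\<Union>i\<in>L. E2 i) + ?P (\<Union>x\<in>I3. E3 x) + ?P (\<Union>x\<in>L \<times> {1..n}. E4 x)"
    by (intro order.trans[OF measure_Un_le] add_mono order.refl) auto
  also have "\<dots> \<le> 1 / real (T + 1) + real (card L) * exp (- (c_min / real nL * real T / 10))
      + real (card I3) * exp (- (K / (real nL)\<^sup>2 * real T))
      + real (card (L \<times> {1..n})) * (2 * exp (- (\<theta> * (\<delta> / real nL) / 2 * real T)))"
  proof (intro add_mono prob_UN_le)
    have "?P E1 \<le> 1 / N"
      unfolding E1_def using N N0 by (intro prob_exists_lik_ratio_ge[OF L A01]) (auto simp: L_def)
    also have "\<dots> \<le> 1 / real (T + 1)" using N1 by (intro divide_left_mono) auto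
    finally show "?P E1 \<le> 1 / real (T + 1)" .
    show "finite L" by (fact L)
    show "finite (L \<times> {1..n})" using L by simp
    show "finite I3" by (rule finite_subset[of _ "L \<times> L"]) (use L in \<open>auto simp: I3_def\<close>)
    show "?P (E2 i) \<le> exp (- (c_min / real nL * real T / 10))" if "i \<in> L" for i
      unfolding E2_def s_def by (rule prob_hub_frequency_le[OF L that]) (use \<rho> that L_def in auto)
    show "?P (E3 x) \<le> exp (- (K / (real nL)\<^sup>2 * real T))" if xI: "x \<in> I3" for x
    proof -
      obtain i k where x: "x = (i, k)" "i \<in> L" "k \<in> L" "i \<noteq> k" using xI by (auto simp: I3_def)
      have k: "k \<in> {1..n}" using x nLn by (auto simp: L_def)
      have "pmf \<rho> i * A i k \<le> c_max / real nL * (c0 / real nL)"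
        using \<rho>[of i] sparse[of i k] x A01[OF x(2) k] c_max by (intro mult_mono) (auto simp: L_def)
      then have c: "pmf \<rho> i * A i k \<le> K / (real nL)\<^sup>2" by (simp add: K power2_eq_square)
      show ?thesis
        unfolding x(1) E3_def prod.case b_def using A01[OF x(2) k] c
        by (intro prob_hub_cooccurrence_ge[where A = A, OF L x(2) k]) simp_all
    qed
    show "?P (E4 x) \<le> 2 * exp (- (\<theta> * (\<delta> / real nL) / 2 * real T))" if xI: "x \<in> L \<times> {1..n}" for x
    proof -
      obtain i j where x: "x = (i, j)" "i \<in> L" "j \<in> {1..n}" using xI by auto
      \<comment> \<open>Both the hub probability and the allowed deviation carry a factor
        \<open>1 / nL\<close>, so the same \<open>\<theta>\<close> serves for every
        \<open>nL\<close> and the exponent is of order \<open>T / nL\<close>.\<close>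
      have "2 * (c_max / real nL) * \<theta> \<le> \<delta> / real nL"
        using divide_right_mono[OF \<theta>(3), of "real nL"] by simp
      then show ?thesis
        unfolding x(1) E4_def prod.case using A01[OF x(2,3)] \<rho>[of i] x(2) \<theta>(1,2)
        by (intro prob_hub_mean_ge[where A = A and c = "c_max / real nL", OF L x(2,3)]) (simp_all only: L_def)
    qed
  qed
  also have "real (card I3) * exp (- (K / (real nL)\<^sup>2 * real T)) \<le>
      (real nL)\<^sup>2 * exp (- (K / (real nL)\<^sup>2 * real T))"
  proof (intro mult_right_mono)
    have "card I3 \<le> card (L \<times> L)" using L by (intro card_mono) (auto simp: I3_def)
    then have "real (card I3) \<le> real (card (L \<times> L))" by (rule of_nat_mono)
    then show "real (card I3) \<le> (real nL)\<^sup>2" by (simp add: L_def power2_eq_square)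
  qed simp
  finally show ?thesis by (simp add: L_def mult.commute[of _ "real nL"])
qed

text \<open>Since \<open>w\<close> outgrows \<open>ln p\<close>, the exponential is eventually at
  most \<open>p\<close> to the power \<open>-(a + 1)\<close>, which leaves
  \<open>1 / p\<close>.\<close>

lemma tendsto_power_mult_exp_neg:
  fixes p w :: "nat \<Rightarrow> real"
  assumes p: "filterlim p at_top sequentially"
    and w: "eventually (\<lambda>m. 0 < w m) sequentially" and lim: "(\<lambda>m. ln (p m) / w m) \<longlonglongrightarrow> 0"
    and \<kappa>: "0 < \<kappa>"
  shows "(\<lambda>m. p m ^ a * exp (- (\<kappa> * w m))) \<longlonglongrightarrow> 0"
proof (rule Lim_null_comparison)
  have "eventually (\<lambda>m. ln (p m) / w m < \<kappa> / real (a + 1)) sequentially"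
    using \<kappa> by (intro order_tendstoD(2)[OF lim]) auto
  moreover have "eventually (\<lambda>m. 0 < p m) sequentially"
    using p by (simp add: filterlim_at_top_dense)
  ultimately show "eventually (\<lambda>m. norm (p m ^ a * exp (- (\<kappa> * w m))) \<le> inverse (p m)) sequentially"
    using w
  proof eventually_elim
    case (elim m)
    have "real (a + 1) * ln (p m) \<le> \<kappa> * w m"
      using elim by (simp add: field_simps)
    then have "exp (real (a + 1) * ln (p m)) \<le> exp (\<kappa> * w m)" by simp
    also have "exp (real (a + 1) * ln (p m)) = p m ^ (a + 1)"
      using elim by (simp only: exp_of_nat_mult exp_ln)
    finally have "p m ^ a * p m \<le> exp (\<kappa> * w m)" by (simp add: mult.commute)
    then show ?case using elim by (simp add: exp_minus field_simps)
  qed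
  show "(\<lambda>m. inverse (p m)) \<longlonglongrightarrow> 0"
    using p by (rule tendsto_inverse_0_at_top)
qed

subsection \<open>Asymptotics\<close>

text \<open>The logarithm splits into \<open>T * ln nL\<close> for the assignments and
  \<open>2 * nL * n * ln (T + 1)\<close> for the matrices. The first part is controlled by
  \<open>rate3\<close>, as \<open>d\<close> and \<open>v\<close> are at most 1, the second by
  \<open>rate2\<close>, as \<open>ln (T + 1) \<le> 2 * ln T\<close> once \<open>T\<close> is at
  least 2.\<close>

lemma log_count_tendsto_0:
  fixes nL n T :: "nat \<Rightarrow> nat" and d v :: "nat \<Rightarrow> real"
  assumes nL_lim: "filterlim nL at_top sequentially" and nLn: "\<And>m. nL m \<le> n m"
    and T_lim: "filterlim T at_top sequentially"
    and d: "\<And>m. 0 < d m" "\<And>m. d m \<le> 1"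
    and v: "\<And>m. 0 < v m" "\<And>m. v m \<le> 1"
    and rate2: "(\<lambda>m. (real (nL m))^3 * ln (real (T m)) / ((d m)^2 * v m * real (T m))) \<longlonglongrightarrow> 0"
    and rate3: "(\<lambda>m. (real (nL m))^4 * ln (real (nL m)) / ((d m)^4 * (v m)^2 * real (n m)))
          \<longlonglongrightarrow> 0"
  shows "(\<lambda>m. 16 * (real (nL m))\<^sup>2 * ln (real (nL m) ^ T m * real (T m + 1) ^ (2 * nL m * n m)) /
      ((d m)\<^sup>2 * v m * real (n m) * real (T m))) \<longlonglongrightarrow> 0"
proof (rule Lim_null_comparison)
  let ?r2 = "\<lambda>m. (real (nL m))^3 * ln (real (T m)) / ((d m)^2 * v m * real (T m))"
  let ?r3 = "\<lambda>m. (real (nL m))^4 * ln (real (nL m)) / ((d m)^4 * (v m)^2 * real (n m))"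
  have "eventually (\<lambda>m. 1 \<le> nL m) sequentially" "eventually (\<lambda>m. 2 \<le> T m) sequentially"
    using nL_lim T_lim by (auto simp: filterlim_at_top)
  then show "eventually (\<lambda>m. norm (16 * (real (nL m))\<^sup>2 * ln (real (nL m) ^ T m * real (T m + 1) ^ (2 * nL m * n m)) /
      ((d m)\<^sup>2 * v m * real (n m) * real (T m))) \<le> 16 * ?r3 m + 64 * ?r2 m) sequentially"
  proof eventually_elim
    case (elim m)
    define N k t D w where "N = real (n m)" and "k = real (nL m)" and "t = real (T m)"
      and "D = (d m)\<^sup>2" and "w = v m"
    have k: "1 \<le> k" and t: "2 \<le> t" and N: "0 < N"
      using elim nLn[of m] by (auto simp: k_def t_def N_def)
    have D: "0 < D" "D \<le> 1" and w: "0 < w" "w \<le> 1"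
      using d[of m] v[of m] by (auto simp: D_def w_def power_le_one)
    have lnk: "0 \<le> ln k" using k by simp
    have "ln (t + 1) \<le> ln (t\<^sup>2)"
    proof -
      have "2 * t \<le> t * t" using t by (intro mult_right_mono) auto
      then have "t + 1 \<le> t\<^sup>2" using t unfolding power2_eq_square by linarith
      then show ?thesis using t by (intro ln_mono) auto
    qed
    then have ln1: "ln (t + 1) \<le> 2 * ln t" "0 \<le> ln (t + 1)" using t by (simp_all add: ln_realpow)
    have "ln (k ^ T m * (t + 1) ^ (2 * nL m * n m)) = t * ln k + 2 * k * N * ln (t + 1)"
      using k t by (simp add: ln_mult ln_realpow t_def k_def N_def)
    then have "16 * k\<^sup>2 * ln (k ^ T m * (t + 1) ^ (2 * nL m * n m)) / (D * w * N * t)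
        = 16 * (k\<^sup>2 * ln k / (D * w * N)) + 32 * (k^3 * ln (t + 1) / (D * w * t))"
      using D w N t by (simp add: field_simps power2_eq_square power3_eq_cube)
    moreover have "0 \<le> k\<^sup>2 * ln k / (D * w * N)" "0 \<le> k^3 * ln (t + 1) / (D * w * t)"
      using k t N D w ln1 by auto
    moreover have "k\<^sup>2 * ln k / (D * w * N) \<le> k^4 * ln k / (D\<^sup>2 * w\<^sup>2 * N)"
    proof (intro frac_le mult_right_mono)
      show "k\<^sup>2 \<le> k ^ 4" using k by (intro power_increasing) auto
      have "D\<^sup>2 \<le> D" "w\<^sup>2 \<le> w" using D w by (auto simp: power2_eq_square mult_left_le)
      then show "D\<^sup>2 * w\<^sup>2 \<le> D * w" using D by (intro mult_mono) auto
    qed (use D w N lnk k in auto)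
    moreover have "k^3 * ln (t + 1) / (D * w * t) \<le> k^3 * (2 * ln t) / (D * w * t)"
      using ln1 k D w t by (intro divide_right_mono mult_left_mono) auto
    moreover have "D\<^sup>2 = (d m)^4" by (simp add: D_def)
    ultimately show ?case
      by (simp add: N_def k_def t_def D_def w_def add.commute)
  qed
  show "(\<lambda>m. 16 * ?r3 m + 64 * ?r2 m) \<longlonglongrightarrow> 0"
    using tendsto_add[OF tendsto_mult_left[OF rate3, of 16] tendsto_mult_left[OF rate2, of 64]] by simp
qed

text \<open>The rates meet the error sources as follows: \<open>rate2\<close> and
  \<open>rate3\<close> make the misassigned share \<open>\<eta>\<close> vanish, \<open>rate1\<close>
  beats the union bounds over hubs and pairs of hubs, and \<open>rate4\<close> beats the one over
  all matrix entries.\<close>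

theorem theorem5:
  fixes nL n T :: "nat \<Rightarrow> nat"
    and \<rho> :: "nat \<Rightarrow> nat pmf"
    and A :: "nat \<Rightarrow> nat \<Rightarrow> nat \<Rightarrow> real"
    and d v :: "nat \<Rightarrow> real"
    and c_min c_max c0 :: real
    and zhat :: "nat \<Rightarrow> (nat \<Rightarrow> nat \<Rightarrow> bool) \<Rightarrow> nat \<Rightarrow> nat"
  assumes params: "\<And>m. hub_params (nL m) (n m) (\<rho> m) (A m)"
    and nL_lim: "filterlim nL at_top sequentially"
    and n_lim: "filterlim n at_top sequentially"
    and T_lim: "filterlim T at_top sequentially"
    and c_min: "c_min > 0" "\<And>m. (MIN i\<in>{1..nL m}. pmf (\<rho> m) i) = c_min / real (nL m)"
    and c_max: "c_max > 0" "\<And>m. (MAX i\<in>{1..nL m}. pmf (\<rho> m) i) = c_max / real (nL m)"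
    and d: "\<And>m. 0 < d m" "\<And>m. d m \<le> 1"
    and v: "\<And>m. 0 < v m" "\<And>m. v m \<le> 1"
    and separation: "\<And>m i. i \<in> {1..nL m} \<Longrightarrow>
          \<exists>V\<subseteq>{1..n m}. real (card V) \<ge> v m * real (n m) / real (nL m) \<and>
            (\<forall>j\<in>V. \<forall>i'\<in>{1..nL m}. i' \<noteq> i \<longrightarrow> A m i j - A m i' j \<ge> d m)"
    and c0: "c0 > 0"
    and hub_sparsity: "\<And>m i i'. i \<in> {1..nL m} \<Longrightarrow> i' \<in> {1..nL m} \<Longrightarrow> i \<noteq> i' \<Longrightarrow>
          A m i i' \<le> c0 / real (nL m)"
    and rate1: "(\<lambda>m. (real (nL m))^2 * ln (real (nL m)) / real (T m)) \<longlonglongrightarrow> 0"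
    and rate2: "(\<lambda>m. (real (nL m))^3 * ln (real (T m)) / ((d m)^2 * v m * real (T m))) \<longlonglongrightarrow> 0"
    and rate3: "(\<lambda>m. (real (nL m))^4 * ln (real (nL m)) / ((d m)^4 * (v m)^2 * real (n m)))
          \<longlonglongrightarrow> 0"
    and rate4: "(\<lambda>m. real (nL m) * ln (real (n m)) / real (T m)) \<longlonglongrightarrow> 0"
    and estimator: "\<And>m. profile_estimator (nL m) (n m) (T m) (zhat m)"
  shows "small_o_prob (\<lambda>m. hub_model_pmf (n m) (T m) (\<rho> m) (A m))
    (\<lambda>m \<omega>. MAX (i, j)\<in>{1..nL m} \<times> {1..n m}.
       \<bar>A_hat (T m) (observed \<omega>) (zhat m (observed \<omega>)) i j - A m i j\<bar>)"
  unfolding small_o_prob_def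
proof (intro allI impI)
  fix \<epsilon> :: real assume \<epsilon>: "\<epsilon> > 0"
  let ?P = "\<lambda>m. measure_pmf.prob (hub_model_pmf (n m) (T m) (\<rho> m) (A m))
    {\<omega>. \<bar>MAX (i, j)\<in>{1..nL m} \<times> {1..n m}.
       \<bar>A_hat (T m) (observed \<omega>) (zhat m (observed \<omega>)) i j - A m i j\<bar>\<bar> > \<epsilon>}"
  define N where "N = (\<lambda>m. real (nL m) ^ T m * real (T m + 1) ^ (2 * nL m * n m))"
  define \<eta> where "\<eta> = (\<lambda>m. 16 * (real (nL m))\<^sup>2 * ln (N m) / ((d m)\<^sup>2 * v m * real (n m) * real (T m)))"
  define u where "u = (\<lambda>m. real (T m) / real (nL m))"
  define w where "w = (\<lambda>m. real (T m) / (real (nL m))\<^sup>2)"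
  define K where "K = c_max * c0"
  \<comment> \<open>Once \<open>\<eta>\<close> is below \<open>\<delta>\<close> and
    \<open>c_min / 16\<close>, the error is at most \<open>3 * \<delta> / (c_min / 4)\<close>, which
    is \<open>3 / 4 * \<epsilon>\<close>.\<close>
  define \<delta> where "\<delta> = \<epsilon> * c_min / 16"
  define \<theta> where "\<theta> = min 1 (\<delta> / (2 * c_max))"
  have K: "0 < K" using c_max c0 by (simp add: K_def)
  have \<delta>: "0 < \<delta>" using \<epsilon> c_min by (simp add: \<delta>_def)
  have \<theta>: "0 < \<theta>" "\<theta> \<le> 1" "2 * c_max * \<theta> \<le> \<delta>"
    using \<delta> c_max by (auto simp: \<theta>_def min_def field_simps)
  have nLn: "nL m \<le> n m" for m using params[of m] by (simp add: hub_params_def)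
  have ev_nL: "eventually (\<lambda>m. 1 \<le> nL m) sequentially" and ev_T: "eventually (\<lambda>m. 1 \<le> T m) sequentially"
    using nL_lim T_lim by (auto simp: filterlim_at_top)
  have real_nL: "filterlim (\<lambda>m. real (nL m)) at_top sequentially"
    and real_n: "filterlim (\<lambda>m. real (n m)) at_top sequentially"
    and real_T: "filterlim (\<lambda>m. real (T m)) at_top sequentially"
    using nL_lim n_lim T_lim by (auto intro: filterlim_compose[OF filterlim_real_sequentially])
  \<comment> \<open>Each exponential term is shaped as a power times a decaying exponential; for
    this \<open>nL * n\<close> is enlarged to \<open>n^2\<close>.\<close>
  define B where "B = (\<lambda>m. 1 / real (T m + 1) + real (nL m) ^ 1 * exp (- (c_min / 10 * u m))
      + (real (nL m))\<^sup>2 * exp (- (K * w m)) + 2 * ((real (n m))\<^sup>2 * exp (- (\<theta> * \<delta> / 2 * u m))))"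
  have B: "B \<longlonglongrightarrow> 0"
  proof -
    have ev_w: "eventually (\<lambda>m. 0 < w m) sequentially" and ev_u: "eventually (\<lambda>m. 0 < u m) sequentially"
      using eventually_conj[OF ev_nL ev_T] by (auto simp: u_def w_def elim!: eventually_mono)
    have lim_w: "(\<lambda>m. ln (real (nL m)) / w m) \<longlonglongrightarrow> 0"
      using rate1 by (simp add: w_def mult.commute)
    have lim_u: "(\<lambda>m. ln (real (nL m)) / u m) \<longlonglongrightarrow> 0"
    \<comment> \<open>As \<open>nL\<close> is eventually at least 1, \<open>u\<close> dominates
      \<open>w\<close>, so the rate for pairs of hubs also covers single hubs.\<close>
    proof (rule Lim_null_comparison[OF _ lim_w])
      show "eventually (\<lambda>m. norm (ln (real (nL m)) / u m) \<le> ln (real (nL m)) / w m) sequentially"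
        using ev_nL
      proof eventually_elim
        case (elim m)
        then have "real (nL m) * 1 \<le> real (nL m) * real (nL m)" by (intro mult_left_mono) auto
        then have "ln (real (nL m)) * real (nL m) \<le> ln (real (nL m)) * (real (nL m))\<^sup>2"
          using elim by (intro mult_left_mono) (auto simp: power2_eq_square)
        then show ?case using elim by (simp add: u_def w_def divide_right_mono)
      qed
    qed
    have lim_n: "(\<lambda>m. ln (real (n m)) / u m) \<longlonglongrightarrow> 0"
      using rate4 by (simp add: u_def mult.commute)
    have "(\<lambda>m. inverse (real (T m + 1))) \<longlonglongrightarrow> 0"
      using real_T by (intro tendsto_inverse_0_at_top)
        (auto intro: filterlim_at_top_mono simp: eventually_sequentially)
    then have T1: "(\<lambda>m. 1 / real (T m + 1)) \<longlonglongrightarrow> 0" by (simp add: inverse_eq_divide)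
    have "B \<longlonglongrightarrow> 0 + 0 + 0 + 2 * 0"
      unfolding B_def
      by (intro tendsto_add tendsto_mult_left T1 tendsto_power_mult_exp_neg real_nL real_n
          ev_u ev_w lim_u lim_w lim_n) (use c_min K \<theta> \<delta> in auto)
    then show ?thesis by simp
  qed
  have \<eta>_lim: "\<eta> \<longlonglongrightarrow> 0"
    unfolding \<eta>_def N_def by (rule log_count_tendsto_0[OF nL_lim nLn T_lim d v rate2 rate3])
  have inv_nL: "(\<lambda>m. c / real (nL m)) \<longlonglongrightarrow> 0" for c :: real
    using real_nL by (intro tendsto_divide_0[OF tendsto_const] filterlim_at_top_imp_at_infinity)
  have "eventually (\<lambda>m. \<eta> m < \<delta>) sequentially" "eventually (\<lambda>m. \<eta> m < c_min / 16) sequentially"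
      "eventually (\<lambda>m. 3 * K / real (nL m) < c_min / 8) sequentially"
      "eventually (\<lambda>m. 9 * K\<^sup>2 / real (nL m) < (c_min / 4)\<^sup>2) sequentially"
    using c_min \<delta> by (intro order_tendstoD(2)[OF \<eta>_lim] order_tendstoD(2)[OF inv_nL]; simp)+
  then have "eventually (\<lambda>m. norm (?P m) \<le> B m) sequentially"
    using ev_nL ev_T
  proof eventually_elim
    case (elim m)
    have "?P m \<le> 1 / real (T m + 1) + real (nL m) * exp (- (c_min / 10 * (real (T m) / real (nL m))))
      + (real (nL m))\<^sup>2 * exp (- (K * (real (T m) / (real (nL m))\<^sup>2)))
      + real (nL m) * real (n m) * (2 * exp (- (\<theta> * \<delta> / 2 * (real (T m) / real (nL m)))))"
    proof (rule prob_error_gt_le[OF params estimator _ hub_sparsity d(1) v(1) elim(6) c_max(1) separation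
          N_def[THEN fun_cong] _ K_def _ _ _ \<theta>])
      show "c_min / real (nL m) \<le> pmf (\<rho> m) i \<and> pmf (\<rho> m) i \<le> c_max / real (nL m)"
        if "i \<in> {1..nL m}" for i
        unfolding c_min(2)[symmetric] c_max(2)[symmetric] using that by auto
      show "16 * real (nL m) * ln (N m) / ((d m)\<^sup>2 * v m * real (n m)) \<le> \<eta> m * (real (T m) / real (nL m))"
        using elim by (simp add: \<eta>_def power2_eq_square)
      show "2 * \<eta> m < c_min / 2" using elim(2) c_min(1) by linarith
      show "\<eta> m + 3 * K / real (nL m) < c_min / 2" using elim(2,3) c_min(1) by linarith
      \<comment> \<open>The two subtracted terms are below \<open>c_min / 16\<close> and
        \<open>c_min / 8\<close>, together less than \<open>c_min / 4\<close>.\<close>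
      have "c_min / 4 \<le> c_min / 2 - \<eta> m - 3 * K / real (nL m)" using elim(2,3) c_min(1) by linarith
      then have "(c_min / 4)\<^sup>2 \<le> (c_min / 2 - \<eta> m - 3 * K / real (nL m))\<^sup>2"
        using c_min(1) by (intro power_mono) auto
      then show "9 * K\<^sup>2 / real (nL m) < (c_min / 2 - \<eta> m - 3 * K / real (nL m))\<^sup>2"
        using elim(4) by linarith
      have "(\<delta> + 2 * \<eta> m) / (c_min / 2 - \<eta> m) \<le> (3 * \<delta>) / (c_min / 4)"
        using elim(1,2) c_min(1) \<delta> by (intro frac_le) auto
      also have "\<dots> \<le> \<epsilon>" using \<epsilon> c_min(1) by (simp add: \<delta>_def field_simps)
      finally show "(\<delta> + 2 * \<eta> m) / (c_min / 2 - \<eta> m) \<le> \<epsilon>" .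
    qed
    also have "\<dots> \<le> B m"
    proof -
      have "real (nL m) * real (n m) \<le> (real (n m))\<^sup>2"
        unfolding power2_eq_square using nLn[of m] by (intro mult_right_mono) auto
      then have "real (nL m) * real (n m) * (2 * exp (- (\<theta> * \<delta> / 2 * u m))) \<le>
          (real (n m))\<^sup>2 * (2 * exp (- (\<theta> * \<delta> / 2 * u m)))"
        by (intro mult_right_mono) auto
      then show ?thesis by (simp add: B_def u_def w_def)
    qed
    finally show ?case by simp
  qed
  then show "?P \<longlonglongrightarrow> 0"
    using B by (rule Lim_null_comparison)
qed

end
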